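(* Let $\mathcal A=\{\mathbf a_1,\ldots,\mathbf a_n\}\subset\mathbb R^d$ be a finite point configuration whose convex hull is $d$-dimensional, and let $\Gamma$ be a triangulation of the convex hull of $\mathcal A$ with vertices in $\mathcal A$. Then the following are equivalent: (i) $\Gamma$ is balanced; (ii) there exists a real $d\times n$ matrix $C$ which positively decorates all the $d$-simplices of $\Gamma$; (iii) the dual graph of $\Gamma$ is bipartite.
   Context: A real $d\times(d+1)$ matrix $M$ is called oriented if the values $(-1)^i\operatorname{minor}(M,i)$, $i=1,\dots,d+1$, are all nonzero and have the same sign, where $\operatorname{minor}(M,i)$ is the determinant of the square matrix obtained by removing the $i$-th column of $M$. A real $d\times n$ matrix $C$ (columns indexed by the points $\mathbf a_1,\dots,\mathbf a_n$) positively decorates a $d$-simplex $\operatorname{conv}(\mathbf a_{i_1},\ldots,\mathbf a_{i_{d+1}})$ if the $d\times(d+1)$ submatrix of $C$ formed by the columns $i_1,\ldots,i_{d+1}$ is oriented. A $d$-dimensional simplicial complex $\Gamma$ with vertices in $\mathcal A$ is balanced if there is a map $\gamma:\mathcal A\to\{1,\ldots,d+1\}$ such that $\gamma(\mathbf a)\neq\gamma(\mathbf a')$ for every edge $\{\mathbf a,\mathbf a'\}$ of $\Gamma$. The dual graph of $\Gamma$ is the graph whose vertices are the $d$-simplices of $\Gamma$, two of them being adjacent when they share a common facet. *)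

theory Defs
  imports
    "HOL-Analysis.Analysis"
    "Jordan_Normal_Form.Determinant"
    "Jordan_Normal_Form.DL_Submatrix"
begin

(* Rows and columns of mat are numbered from 0, so the i-th column of the mathematical
   text (1-based) is column i - 1 here. *)
definition minor :: "real mat \<Rightarrow> nat \<Rightarrow> real" where
  "minor M i = Determinant.det (submatrix M UNIV (- {i - 1}))"

definition oriented :: "real mat \<Rightarrow> bool" where
  "oriented M \<longleftrightarrow>
     dim_col M = dim_row M + 1 \<and>
     (\<forall>i\<in>{1..dim_row M + 1}. (-1) ^ i * minor M i \<noteq> 0) \<and>
     (\<forall>i\<in>{1..dim_row M + 1}. \<forall>j\<in>{1..dim_row M + 1}.
        sgn ((-1) ^ i * minor M i) = sgn ((-1) ^ j * minor M j))"

(* Column j of C belongs to the point a j.  The set I is {i_1 < ... < i_{d+1}}; when a is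
   injective on the column indices and S is a d-simplex, S determines I. *)
definition positively_decorates ::
    "real mat \<Rightarrow> (nat \<Rightarrow> 'a::euclidean_space) \<Rightarrow> 'a set \<Rightarrow> bool" where
  "positively_decorates C a S \<longleftrightarrow>
     (\<exists>I \<subseteq> {..<dim_col C}. card I = dim_row C + 1 \<and>
        S = convex hull (a ` I) \<and> oriented (submatrix C UNIV I))"

(* A simplicial complex contains all faces of its cells, so {v. {v} \<in> \<Gamma>} is its vertex set.
   Not every point of A needs to be a vertex. *)
definition triangulates :: "'a::euclidean_space set set \<Rightarrow> 'a set \<Rightarrow> bool" where
  "triangulates \<Gamma> A \<longleftrightarrow>
     simplicial_complex \<Gamma> \<and> \<Union>\<Gamma> = convex hull A \<and> {v. {v} \<in> \<Gamma>} \<subseteq> A"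

definition balanced :: "'a::euclidean_space set \<Rightarrow> nat \<Rightarrow> 'a set set \<Rightarrow> bool" where
  "balanced A d \<Gamma> \<longleftrightarrow>
     (\<exists>\<gamma> :: 'a \<Rightarrow> nat. \<gamma> ` A \<subseteq> {1..d + 1} \<and>
        (\<forall>x\<in>A. \<forall>y\<in>A. x \<noteq> y \<and> convex hull {x, y} \<in> \<Gamma> \<longrightarrow> \<gamma> x \<noteq> \<gamma> y))"

(* Undirected graphs are pairs of a vertex set and a set of two-element edges. *)
definition dual_graph :: "nat \<Rightarrow> 'a::euclidean_space set set \<Rightarrow> 'a set set \<times> 'a set set set" where
  "dual_graph d \<Gamma> =
     ({S \<in> \<Gamma>. int d simplex S},
      {{S, T} | S T. S \<in> \<Gamma> \<and> T \<in> \<Gamma> \<and> int d simplex S \<and> int d simplex T \<and> S \<noteq> T \<and>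
         (\<exists>F. F facet_of S \<and> F facet_of T)})"

definition bipartite :: "'v set \<times> 'v set set \<Rightarrow> bool" where
  "bipartite G \<longleftrightarrow>
     (\<exists>X Y. X \<union> Y = fst G \<and> X \<inter> Y = {} \<and>
        (\<forall>e \<in> snd G. \<exists>x\<in>X. \<exists>y\<in>Y. e = {x, y}))"

end

theory Submission
  imports Defs
begin

text \<open>
  Let $\varepsilon$ stand for a 2-colouring of the $d$-simplices, $d$ being the dimension of the space.
  The proof runs round the circle from balanced to decorated to bipartite and back to balanced.

  Balanced implies decorated: give the columns of colour $1, \dots, d$ the standard basis vectors and
  those of colour $d + 1$ minus the sum of these. By Cramer's rule a matrix is oriented iff its kernel
  is a line spanned by a strictly positive vector (\<open>oriented_submatrix_iff\<close>); here every $d$-simplex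
  carries all the colours, so that vector is the constant one.

  Decorated implies bipartite: fix an enumeration of the $d + 1$ vertices of a $d$-simplex and compare
  the signs of two determinants, that of the points themselves and that of their columns in $C$, both
  homogenised by a row of ones. Their product does not depend on the enumeration. If a simplex is
  replaced by an adjacent one, and the new vertex takes the place of the old one, then the first
  determinant changes sign, the two vertices lying on opposite sides of the common facet
  (\<open>frame_det_flip\<close>), whereas the second keeps it: by Cramer's rule both values are positive multiples
  of the determinant with the origin in that place. The sign of the product is the 2-colouring.

  Bipartite implies balanced: a bijection from the colours to the vertices of a $d$-simplex has an
  orientation, and only those are admitted whose orientation agrees with $\varepsilon$. Colourings of
  adjacent simplices that agree on the common facet are then admitted or refused together, and an
  admitted colouring is determined by its values on all but two vertices. Consequently admitted
  colourings can be transferred, uniquely and consistently, around every point whose smallest face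
  has codimension at most two (\<open>agree_if_equal_on_codim2\<close>, \<open>agree_trans_at\<close>). It remains to exclude
  monodromy. The space is convex, and faces of codimension three or more are missed by a generic
  triangle. So a colouring of one simplex is continued along segments issuing from a fixed point of
  that simplex (\<open>coherent_along_segment\<close>), and the result does not change when the end point of the
  segment moves along an edge of a generic triangle (\<open>coherent_triangle\<close>). This gives colourings of all
  $d$-simplices that agree across facets (\<open>global_coloring\<close>). Two simplices with a common vertex are
  joined, near that vertex, by a segment that crosses simplices only through facets, so that they give
  the vertex the same colour (\<open>vertex_coloring\<close>).
\<close>

section \<open>Determinants of frames and barycentric coordinates\<close>

text \<open>
  The points are lifted to the affine hyperplane at height one, so that affine dependence
  becomes linear dependence.
\<close>

definition hmg :: "real ^ 'd \<Rightarrow> real ^ 'd option" where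
  "hmg x = (\<chi> i. case i of None \<Rightarrow> 1 | Some j \<Rightarrow> vec_nth x j)"

text \<open>
  The index type has one element more than the dimension, and its elements later serve as the
  colours.
\<close>

definition frame_det :: "('d::finite option \<Rightarrow> real ^ 'd) \<Rightarrow> real" where
  "frame_det e = Determinants.det (\<chi> i j. vec_nth (hmg (e j)) i)"

lemma sum_delta_scaleR:
  fixes f :: "'k::finite \<Rightarrow> 'a::real_vector"
  shows "(\<Sum>j\<in>UNIV. (if j = k then a else 0) *\<^sub>R f j) = a *\<^sub>R f k"
proof -
  have "(\<lambda>j. (if j = k then a else 0) *\<^sub>R f j) = (\<lambda>j. if j = k then a *\<^sub>R f j else 0)" by auto
  then show ?thesis unfolding \<open>_ = _\<close> by simp
qed

lemma all_option_iff: "(\<forall>x. P x) \<longleftrightarrow> P None \<and> (\<forall>x. P (Some x))"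
  by (metis not_None_eq)

lemma hmg_matrix_mult:
  fixes e :: "'d::finite option \<Rightarrow> real ^ 'd"
  shows "(\<chi> i j. vec_nth (hmg (e j)) i) *v (\<chi> k. \<mu> k) =
    (\<chi> i. case i of None \<Rightarrow> sum \<mu> UNIV | Some j \<Rightarrow> vec_nth (\<Sum>k\<in>UNIV. \<mu> k *\<^sub>R e k) j)"
  by (auto simp: Finite_Cartesian_Product.vec_eq_iff matrix_vector_mult_def hmg_def mult.commute split: option.splits)

text \<open>
  This is Cramer's rule: the barycentric coordinates of a point are quotients of frame
  determinants.
\<close>

lemma frame_det_cramer:
  fixes e :: "'d::finite option \<Rightarrow> real ^ 'd"
  assumes "sum \<mu> UNIV = 1" "(\<Sum>k\<in>UNIV. \<mu> k *\<^sub>R e k) = x"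
  shows "frame_det (e(k := x)) = \<mu> k * frame_det e"
proof -
  let ?A = "(\<chi> i j. vec_nth (hmg (e j)) i)"
  have "?A *v (\<chi> k. \<mu> k) = hmg x"
    unfolding hmg_matrix_mult using assms by (simp add: hmg_def)
  then show ?thesis
    using cramer_lemma[where k = k and A = ?A and x = "\<chi> k. \<mu> k"]
    unfolding frame_det_def by (simp add: if_distrib if_distribR cong: if_cong)
qed

lemma frame_det_nz_iff:
  fixes e :: "'d::finite option \<Rightarrow> real ^ 'd"
  shows "frame_det e \<noteq> 0 \<longleftrightarrow>
    (\<forall>\<mu>. sum \<mu> UNIV = 0 \<and> (\<Sum>k\<in>UNIV. \<mu> k *\<^sub>R e k) = 0 \<longrightarrow> (\<forall>k. \<mu> k = 0))"
proof -
  let ?A = "(\<chi> i j. vec_nth (hmg (e j)) i)"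
  have eq: "?A *v (\<chi> k. \<mu> k) = 0 \<longleftrightarrow> sum \<mu> UNIV = 0 \<and> (\<Sum>k\<in>UNIV. \<mu> k *\<^sub>R e k) = 0" for \<mu>
  proof -
    have "?A *v (\<chi> k. \<mu> k) = 0 \<longleftrightarrow> (\<forall>i. vec_nth (?A *v (\<chi> k. \<mu> k)) i = 0)"
      by (simp add: Finite_Cartesian_Product.vec_eq_iff)
    also have "\<dots> \<longleftrightarrow> sum \<mu> UNIV = 0 \<and> (\<forall>j. vec_nth (\<Sum>k\<in>UNIV. \<mu> k *\<^sub>R e k) j = 0)"
      unfolding hmg_matrix_mult all_option_iff by simp
    finally show ?thesis by (simp add: Finite_Cartesian_Product.vec_eq_iff)
  qed
  have "frame_det e \<noteq> 0 \<longleftrightarrow> (\<forall>x. ?A *v x = 0 \<longrightarrow> x = 0)"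
    unfolding frame_det_def invertible_det_nz[symmetric] invertible_left_inverse
      matrix_left_invertible_ker ..
  also have "\<dots> \<longleftrightarrow> (\<forall>\<mu>. ?A *v (\<chi> k. \<mu> k) = 0 \<longrightarrow> (\<chi> k. \<mu> k) = 0)"
  proof (intro iffI allI impI)
    fix x assume "\<forall>\<mu>. ?A *v (\<chi> k. \<mu> k) = 0 \<longrightarrow> (\<chi> k. \<mu> k) = 0" "?A *v x = 0"
    then show "x = 0" by (auto dest: spec[of _ "vec_nth x"])
  qed blast
  finally show ?thesis
    unfolding eq by (simp add: Finite_Cartesian_Product.vec_eq_iff)
qed

lemma barycentric_ex:
  fixes e :: "'d::finite option \<Rightarrow> real ^ 'd"
  assumes "frame_det e \<noteq> 0"
  obtains \<mu> where "sum \<mu> UNIV = 1" "(\<Sum>k\<in>UNIV. \<mu> k *\<^sub>R e k) = x"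
proof -
  let ?A = "(\<chi> i j. vec_nth (hmg (e j)) i)"
  have "invertible ?A" using assms unfolding frame_det_def invertible_det_nz .
  then obtain v where v: "?A *v v = hmg x"
    by (metis invertible_right_inverse matrix_right_invertible_surjective surjE)
  define \<mu> where "\<mu> = vec_nth v"
  have "v = (\<chi> k. \<mu> k)" by (simp add: \<mu>_def)
  then have h: "(\<chi> i. case i of None \<Rightarrow> sum \<mu> UNIV | Some j \<Rightarrow> vec_nth (\<Sum>k\<in>UNIV. \<mu> k *\<^sub>R e k) j) = hmg x"
    using v unfolding hmg_matrix_mult[symmetric] by simp
  show ?thesis
  proof
    have h': "(case i of None \<Rightarrow> sum \<mu> UNIV | Some j \<Rightarrow> vec_nth (\<Sum>k\<in>UNIV. \<mu> k *\<^sub>R e k) j)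
      = vec_nth (hmg x) i" for i
      unfolding h[symmetric] by simp
    show "sum \<mu> UNIV = 1" using h'[of None] by (simp add: hmg_def)
    have "vec_nth (\<Sum>k\<in>UNIV. \<mu> k *\<^sub>R e k) j = vec_nth x j" for j
      using h'[of "Some j"] by (simp add: hmg_def)
    then show "(\<Sum>k\<in>UNIV. \<mu> k *\<^sub>R e k) = x" by (simp add: Finite_Cartesian_Product.vec_eq_iff)
  qed
qed

lemma barycentric_unique:
  fixes e :: "'d::finite option \<Rightarrow> real ^ 'd"
  assumes "frame_det e \<noteq> 0" "sum \<mu> UNIV = sum \<nu> UNIV"
    "(\<Sum>k\<in>UNIV. \<mu> k *\<^sub>R e k) = (\<Sum>k\<in>UNIV. \<nu> k *\<^sub>R e k)"
  shows "\<mu> k = \<nu> k"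
proof -
  have "sum (\<lambda>k. \<mu> k - \<nu> k) UNIV = 0" "(\<Sum>k\<in>UNIV. (\<mu> k - \<nu> k) *\<^sub>R e k) = 0"
    using assms by (auto simp: sum_subtractf scaleR_left_diff_distrib)
  then show ?thesis using assms(1) unfolding frame_det_nz_iff by fastforce
qed

lemma frame_det_nz_iff_affine_independent:
  fixes e :: "'d::finite option \<Rightarrow> real ^ 'd"
  shows "frame_det e \<noteq> 0 \<longleftrightarrow> inj e \<and> \<not> affine_dependent (range e)"
proof (intro iffI conjI)
  assume nz: "frame_det e \<noteq> 0"
  show inj: "inj e"
  proof (rule injI, rule ccontr)
    fix k l assume kl: "e k = e l" "k \<noteq> l"
    have "(1::real) = 0"
      using barycentric_unique[OF nz, of "\<lambda>j. if j = k then 1 else 0" "\<lambda>j. if j = l then 1 else 0" k] kl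
      by (simp add: sum_delta_scaleR)
    then show False by simp
  qed
  show "\<not> affine_dependent (range e)"
  proof
    assume "affine_dependent (range e)"
    then obtain U where U: "sum U (range e) = 0" "\<exists>v\<in>range e. U v \<noteq> 0"
      "sum (\<lambda>v. U v *\<^sub>R v) (range e) = 0"
      using affine_dependent_explicit_finite[of "range e"] by auto
    then show False
      using nz unfolding frame_det_nz_iff by (auto simp: sum.reindex[OF inj] o_def)
  qed
next
  assume e: "inj e \<and> \<not> affine_dependent (range e)"
  show "frame_det e \<noteq> 0"
    unfolding frame_det_nz_iff
  proof (intro allI impI)
    fix \<mu> k assume m: "sum \<mu> UNIV = 0 \<and> (\<Sum>k\<in>UNIV. \<mu> k *\<^sub>R e k) = 0"
    have "sum (\<mu> \<circ> inv_into UNIV e) (range e) = 0" "sum (\<lambda>v. (\<mu> \<circ> inv_into UNIV e) v *\<^sub>R v) (range e) = 0"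
      using e m by (auto simp: sum.reindex o_def)
    then have "\<not> (\<exists>v\<in>range e. (\<mu> \<circ> inv_into UNIV e) v \<noteq> 0)"
      using e iffD2[OF affine_dependent_explicit_finite[OF finite_imageI[OF finite]], of e UNIV]
      by blast
    then show "\<mu> k = 0" using e by auto
  qed
qed

lemma frame_det_permute:
  fixes e :: "'d::finite option \<Rightarrow> real ^ 'd"
  assumes "p permutes UNIV"
  shows "frame_det (e \<circ> p) = of_int (sign p) * frame_det e"
  using det_permute_columns[OF assms, of "\<chi> i j. vec_nth (hmg (e j)) i"]
  unfolding frame_det_def by simp

lemma frame_det_swap:
  fixes e :: "'d::finite option \<Rightarrow> real ^ 'd"
  assumes "i \<noteq> j"
  shows "frame_det (e \<circ> Transposition.transpose i j) = - frame_det e"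
  using frame_det_permute[of "Transposition.transpose i j" e] assms
  by (simp add: permutes_swap_id sign_swap_id)

lemma in_convex_hull_image:
  fixes e :: "'k::finite \<Rightarrow> 'a::real_vector"
  assumes "inj e" "x \<in> convex hull (e ` K)"
  obtains \<mu> where "\<And>k. \<mu> k \<ge> 0" "\<And>k. k \<notin> K \<Longrightarrow> \<mu> k = 0" "sum \<mu> UNIV = 1"
    "(\<Sum>k\<in>UNIV. \<mu> k *\<^sub>R e k) = x"
proof -
  obtain u where u: "\<forall>v\<in>e`K. 0 \<le> u v" "sum u (e`K) = 1" "sum (\<lambda>v. u v *\<^sub>R v) (e`K) = x"
    using assms(2) convex_hull_finite[of "e ` K"] by auto
  have ij: "inj_on e K" using assms(1) inj_on_subset by blast
  define \<mu> where "\<mu> k = (if k \<in> K then u (e k) else 0)" for k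
  show ?thesis
  proof
    show "\<mu> k \<ge> 0" for k using u by (simp add: \<mu>_def)
    show "k \<notin> K \<Longrightarrow> \<mu> k = 0" for k by (simp add: \<mu>_def)
    show "sum \<mu> UNIV = 1"
      using u(2) unfolding \<mu>_def sum.reindex[OF ij] by (simp add: sum.If_cases)
    have "(\<Sum>k\<in>UNIV. \<mu> k *\<^sub>R e k) = (\<Sum>k\<in>UNIV. if k \<in> K then u (e k) *\<^sub>R e k else 0)"
      by (rule sum.cong) (auto simp: \<mu>_def)
    then show "(\<Sum>k\<in>UNIV. \<mu> k *\<^sub>R e k) = x"
      using u(3) unfolding sum.reindex[OF ij] by (simp add: sum.If_cases)
  qed
qed

text \<open>
  If the replaced vertex and its replacement lay on the same side of the common facet, then a
  point slightly off the barycentre of that facet, in the direction of the new vertex, would lie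
  in both simplices without lying in the facet.
\<close>

lemma frame_det_flip:
  fixes e :: "'d::finite option \<Rightarrow> real ^ 'd"
  assumes nz: "frame_det e \<noteq> 0" "frame_det (e(k := q)) \<noteq> 0"
    and face: "convex hull (range e) \<inter> convex hull (range (e(k := q))) \<subseteq> convex hull (e ` (-{k}))"
  shows "frame_det (e(k := q)) * frame_det e < 0"
proof -
  obtain \<mu> where \<mu>: "sum \<mu> UNIV = 1" "(\<Sum>k\<in>UNIV. \<mu> k *\<^sub>R e k) = q"
    using barycentric_ex[OF nz(1)] by blast
  have dq: "frame_det (e(k := q)) = \<mu> k * frame_det e" by (rule frame_det_cramer[OF \<mu>])
  have inj: "inj e" using nz(1) frame_det_nz_iff_affine_independent by blast
  have "\<not> \<mu> k > 0"
  proof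
    assume pos: "\<mu> k > 0"
    let ?d = "real CARD('d)"
    define M where "M = (\<Sum>j\<in>UNIV. \<bar>\<mu> j\<bar>)"
    \<comment> \<open>The share of each facet vertex in the barycentre, \<open>(1 - \<eta>) / d\<close>, then equals \<open>M * \<eta>\<close> and outweighs any negative coordinate of q.\<close>
    define \<eta> where "\<eta> = 1 / (1 + ?d * M)"
    have Mj: "\<bar>\<mu> j\<bar> \<le> M" for j unfolding M_def by (rule member_le_sum) auto
    have d0: "?d > 0" by simp
    have M0: "M \<ge> 0" using Mj[of k] by linarith
    have dM: "1 + ?d * M > 0" using d0 M0 by (simp add: add_pos_nonneg)
    have \<eta>01: "0 < \<eta>" "\<eta> \<le> 1" "\<eta> * (1 + ?d * M) = 1"
      using dM d0 M0 by (auto simp: \<eta>_def)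
    then have "1 - \<eta> = ?d * (M * \<eta>)" by (simp add: algebra_simps)
    then have \<eta>: "0 < \<eta>" "\<eta> \<le> 1" "(1 - \<eta>) / ?d = M * \<eta>"
      using d0 \<eta>01 by auto
    define \<nu> where "\<nu> j = (if j = k then \<eta> * \<mu> k else (1 - \<eta>) / ?d + \<eta> * \<mu> j)" for j
    define c where "c j = (if j = k then 0 else 1 / ?d)" for j
    have \<nu>c: "\<nu> j = (1 - \<eta>) * c j + \<eta> * \<mu> j" for j by (simp add: \<nu>_def c_def)
    have \<nu>0: "\<nu> j \<ge> 0" for j
    proof (cases "j = k")
      case False
      have "\<bar>\<eta> * \<mu> j\<bar> \<le> M * \<eta>" using Mj[of j] \<eta>(1) by (simp add: abs_mult mult.commute mult_right_mono)
      then show ?thesis using False \<eta>(3) by (simp add: \<nu>_def)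
    qed (use pos \<eta> in \<open>simp add: \<nu>_def\<close>)
    have sc: "sum c UNIV = 1"
      unfolding c_def 
    by (simp add: sum.If_cases Collect_neg_eq[symmetric] Compl_eq_Diff_UNIV card_Diff_singleton card_UNIV_option)
    have s\<nu>: "sum \<nu> UNIV = 1"
      unfolding \<nu>c sum.distrib sum_distrib_left[symmetric] sc \<mu> by simp
    define y where "y = (\<Sum>j\<in>UNIV. \<nu> j *\<^sub>R e j)"
    have y1: "y \<in> convex hull (range e)"
      unfolding y_def by (rule convex_sum) (auto simp: s\<nu> \<nu>0 hull_inc)
    have y2: "y = (\<Sum>j\<in>UNIV. ((1 - \<eta>) * c j + (if j = k then \<eta> else 0)) *\<^sub>R (e(k := q)) j)"
    proof -
      have "y = (\<Sum>j\<in>UNIV. ((1 - \<eta>) * c j) *\<^sub>R e j) + \<eta> *\<^sub>R q"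
        unfolding y_def \<nu>c \<mu>(2)[symmetric]
        by (simp add: scaleR_left_distrib sum.distrib scaleR_sum_right)
      also have "(\<Sum>j\<in>UNIV. ((1 - \<eta>) * c j) *\<^sub>R e j) = (\<Sum>j\<in>UNIV. ((1 - \<eta>) * c j) *\<^sub>R (e(k := q)) j)"
        by (rule sum.cong) (auto simp: c_def)
      also have "\<eta> *\<^sub>R q = (\<Sum>j\<in>UNIV. (if j = k then \<eta> else 0) *\<^sub>R (e(k := q)) j)"
        by (simp add: sum_delta_scaleR)
      finally show ?thesis by (simp add: scaleR_left_distrib sum.distrib)
    qed
    have y3: "y \<in> convex hull (range (e(k := q)))"
      unfolding y2
    proof (rule convex_sum)
      show "(\<Sum>j\<in>UNIV. (1 - \<eta>) * c j + (if j = k then \<eta> else 0)) = 1"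
        unfolding sum.distrib sum_distrib_left[symmetric] sc by simp
      show "0 \<le> (1 - \<eta>) * c j + (if j = k then \<eta> else 0)" for j
        using \<eta> by (simp add: c_def)
    qed (auto intro!: hull_inc simp del: fun_upd_apply)
    have "y \<in> convex hull (e ` (-{k}))" using face y1 y3 by blast
    then obtain \<rho> where \<rho>: "\<And>j. j \<notin> -{k} \<Longrightarrow> \<rho> j = 0" "sum \<rho> UNIV = 1" "(\<Sum>j\<in>UNIV. \<rho> j *\<^sub>R e j) = y"
      using in_convex_hull_image[OF inj, of y "-{k}"] by metis
    have "\<nu> k = \<rho> k"
      by (rule barycentric_unique[OF nz(1)]) (use s\<nu> \<rho> in \<open>auto simp: y_def\<close>)
    also have "\<dots> = 0" using \<rho>(1)[of k] by simp
    finally show False using pos \<eta>(1) by (simp add: \<nu>_def)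
  qed
  moreover have "\<mu> k \<noteq> 0" using nz dq by auto
  ultimately have "\<mu> k < 0" by simp
  moreover have "frame_det e * frame_det e > 0"
    using nz(1) by (simp add: zero_less_mult_iff) linarith
  ultimately show ?thesis unfolding dq by (simp add: mult.assoc mult_neg_pos)
qed

section \<open>Oriented matrices and positive kernel vectors\<close>

text \<open>
  The matrix has the columns 0 to d, one more than it has rows.
\<close>

definition in_kernel :: "real mat \<Rightarrow> nat \<Rightarrow> (nat \<Rightarrow> real) \<Rightarrow> bool" where
  "in_kernel M d \<mu> \<longleftrightarrow> (\<forall>r<d. (\<Sum>j\<le>d. M $$ (r, j) * \<mu> j) = 0)"

lemma bij_betw_insert_index:
  assumes "k \<le> d"
  shows "bij_betw (insert_index k) {..<d} ({..d} - {k})"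
proof (rule bij_betw_byWitness[where f' = "delete_index k"])
  show "\<forall>a'\<in>{..d} - {k}. insert_index k (delete_index k a') = a'"
    using insert_delete_index by auto
  show "insert_index k ` {..<d} \<subseteq> {..d} - {k}" by (auto simp: insert_index_def)
  show "delete_index k ` ({..d} - {k}) \<subseteq> {..<d}" using assms by (auto simp: delete_index_def)
qed auto

lemma pick_Compl_singleton: "pick (- {k}) c = insert_index k c"
proof -
  have "{a \<in> -{k}. a < insert_index k c} = insert_index k ` {..<c}"
  proof (intro equalityI subsetI)
    fix a assume "a \<in> {a \<in> -{k}. a < insert_index k c}"
    then have "a = insert_index k (delete_index k a)" "delete_index k a < c"
      by (auto simp: insert_index_def delete_index_def split: if_splits)
    then show "a \<in> insert_index k ` {..<c}" by blast
  qed (auto simp: insert_index_def)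
  moreover have "inj_on (insert_index k) {..<c}"
    by (rule inj_on_inverseI[where g = "delete_index k"]) simp
  ultimately have "card {a \<in> -{k}. a < insert_index k c} = c" by (simp add: card_image)
  moreover have "insert_index k c \<in> -{k}" by (auto simp: insert_index_def)
  ultimately show ?thesis using pick_card_in_set by metis
qed

lemma minor_eq_det:
  assumes "M \<in> carrier_mat d (Suc d)" "k \<le> d"
  shows "minor M (Suc k) = Determinant.det (mat d d (\<lambda>(r, c). M $$ (r, insert_index k c)))"
proof -
  have "{j. j < dim_col M \<and> j \<in> -{k}} = {..d} - {k}" using assms by auto
  then have "card {j. j < dim_col M \<and> j \<in> -{k}} = d" using assms by simp
  moreover have "card {i. i < dim_row M \<and> i \<in> UNIV} = d" using assms by simp
  ultimately show ?thesis
    unfolding minor_def submatrix_def by (simp add: pick_Compl_singleton pick_UNIV)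
qed

text \<open>
  Placing a copy of a row on top of the matrix gives a square matrix with two equal rows; its
  expansion along the first row is the claimed relation.
\<close>

lemma signed_minors_in_kernel:
  assumes M: "M \<in> carrier_mat d (Suc d)"
  shows "in_kernel M d (\<lambda>k. (-1) ^ Suc k * minor M (Suc k))"
  unfolding in_kernel_def
proof (intro allI impI)
  fix r assume r: "r < d"
  define B where "B = mat (Suc d) (Suc d) (\<lambda>(i, j). if i = 0 then M $$ (r, j) else M $$ (i - 1, j))"
  have B: "B \<in> carrier_mat (Suc d) (Suc d)" by (simp add: B_def)
  have "Determinant.det B = 0"
    by (rule det_identical_rows[OF B, of 0 "Suc r"]) (use r in \<open>auto simp: B_def intro!: eq_vecI\<close>)
  then have "0 = (\<Sum>j<Suc d. B $$ (0, j) * cofactor B 0 j)"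
    using laplace_expansion_row[OF B, of 0] by simp
  also have "\<dots> = (\<Sum>j<Suc d. - (M $$ (r, j) * ((-1) ^ Suc j * minor M (Suc j))))"
  proof (rule sum.cong[OF refl])
    fix j assume "j \<in> {..<Suc d}"
    then have j: "j \<le> d" by simp
    have "mat_delete B 0 j = mat d d (\<lambda>(r, c). M $$ (r, insert_index j c))"
      unfolding mat_delete_def B_def
      by (rule eq_matI) (use j in \<open>auto simp: insert_index_def\<close>)
    then have "cofactor B 0 j = (-1) ^ j * minor M (Suc j)"
      unfolding cofactor_def minor_eq_det[OF M j] by simp
    then show "B $$ (0, j) * cofactor B 0 j = - (M $$ (r, j) * ((-1) ^ Suc j * minor M (Suc j)))"
      using j by (simp add: B_def)
  qed
  finally show "(\<Sum>j\<le>d. M $$ (r, j) * ((-1) ^ Suc j * minor M (Suc j))) = 0"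
    by (simp add: sum_negf lessThan_Suc_atMost)
qed

text \<open>
  The kernel of the square matrix with column k deleted consists of the kernel vectors of M that
  vanish at k.
\<close>

lemma minor_nz_iff:
  assumes M: "M \<in> carrier_mat d (Suc d)" and k: "k \<le> d"
  shows "minor M (Suc k) \<noteq> 0 \<longleftrightarrow>
    (\<forall>\<mu>. \<mu> k = 0 \<and> in_kernel M d \<mu> \<longrightarrow> (\<forall>j\<le>d. \<mu> j = 0))"
proof -
  let ?A = "mat d d (\<lambda>(r, c). M $$ (r, insert_index k c))"
  note bij = bij_betw_insert_index[OF k]
  have ker: "in_kernel M d \<mu> \<longleftrightarrow> ?A *\<^sub>v vec d (\<lambda>c. \<mu> (insert_index k c)) = 0\<^sub>v d"
    if "\<mu> k = 0" for \<mu>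
  proof -
    have "(\<Sum>j\<le>d. M $$ (r, j) * \<mu> j) = (\<Sum>c<d. M $$ (r, insert_index k c) * \<mu> (insert_index k c))" for r
      using sum.reindex_bij_betw[OF bij, of "\<lambda>j. M $$ (r, j) * \<mu> j"] that k
      by (simp add: sum.remove[of "{..d}" k])
    then show ?thesis
      unfolding in_kernel_def by (auto simp: scalar_prod_def lessThan_atLeast0 Matrix.vec_eq_iff)
  qed
  show ?thesis
  proof
    assume "minor M (Suc k) \<noteq> 0"
    then have nz: "Determinant.det ?A \<noteq> 0" using minor_eq_det[OF M k] by simp
    show "\<forall>\<mu>. \<mu> k = 0 \<and> in_kernel M d \<mu> \<longrightarrow> (\<forall>j\<le>d. \<mu> j = 0)"
    proof (intro allI impI)
      fix \<mu> j assume m: "\<mu> k = 0 \<and> in_kernel M d \<mu>" and j: "j \<le> d"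
      then have "vec d (\<lambda>c. \<mu> (insert_index k c)) = 0\<^sub>v d"
        using ker[of \<mu>] det_0_iff_vec_prod_zero_field[of ?A d] nz
        by (metis mat_carrier vec_carrier)
      then have z: "\<mu> (insert_index k c) = 0" if "c < d" for c
        using that by (metis index_vec index_zero_vec(1))
      show "\<mu> j = 0"
      proof (cases "j = k")
        case False
        then have "j \<in> insert_index k ` {..<d}" using bij_betw_imp_surj_on[OF bij] j by auto
        then show ?thesis using z by auto
      qed (use m in simp)
    qed
  next
    assume R: "\<forall>\<mu>. \<mu> k = 0 \<and> in_kernel M d \<mu> \<longrightarrow> (\<forall>j\<le>d. \<mu> j = 0)"
    show "minor M (Suc k) \<noteq> 0"
    proof
      assume "minor M (Suc k) = 0"
      then have "Determinant.det ?A = 0" using minor_eq_det[OF M k] by simp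
      then obtain v where v: "v \<in> carrier_vec d" "v \<noteq> 0\<^sub>v d" "?A *\<^sub>v v = 0\<^sub>v d"
        using det_0_iff_vec_prod_zero_field[of ?A d] by auto
      define \<mu> where "\<mu> j = (if j = k then 0 else vec_index v (delete_index k j))" for j
      have \<mu>: "\<mu> (insert_index k c) = vec_index v c" for c
        unfolding \<mu>_def by (auto simp: insert_index_def delete_index_def)
      have "vec d (\<lambda>c. \<mu> (insert_index k c)) = v"
        unfolding \<mu> using v(1) by auto
      moreover have \<mu>k: "\<mu> k = 0" by (simp add: \<mu>_def)
      ultimately have "in_kernel M d \<mu>" using ker[of \<mu>] v(3) by simp
      then have "\<forall>j\<le>d. \<mu> j = 0" using R \<mu>k by blast
      then have "\<mu> (insert_index k c) = 0" if "c < d" for c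
        using that bij by (auto simp: bij_betw_def)
      then have "v = 0\<^sub>v d" using v(1) unfolding \<mu> by (intro eq_vecI) auto
      with v(2) show False by simp
    qed
  qed
qed

text \<open>
  The vector of signed minors lies in the kernel and spans it as soon as one minor is nonzero;
  orientedness says that it has entries of one strict sign.
\<close>

lemma oriented_iff_kernel:
  assumes M: "M \<in> carrier_mat d (Suc d)"
  shows "oriented M \<longleftrightarrow>
    (\<exists>w. (\<forall>j\<le>d. w j > 0) \<and> in_kernel M d w \<and>
      (\<forall>\<mu>. in_kernel M d \<mu> \<longrightarrow> (\<exists>t. \<forall>j\<le>d. \<mu> j = t * w j)))"
proof -
  define m where "m k = (-1) ^ Suc k * minor M (Suc k)" for k
  have mker: "in_kernel M d m" unfolding m_def by (rule signed_minors_in_kernel[OF M])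
  have nz: "m k \<noteq> 0 \<longleftrightarrow> minor M (Suc k) \<noteq> 0" for k by (simp add: m_def)
  have set: "{1..dim_row M + 1} = Suc ` {..d}" using M by (simp add: image_Suc_atMost)
  have o: "oriented M \<longleftrightarrow> (\<forall>k\<le>d. m k \<noteq> 0) \<and> (\<forall>k\<le>d. \<forall>l\<le>d. sgn (m k) = sgn (m l))"
    unfolding oriented_def set m_def using M by auto
  show ?thesis
  proof
    assume or: "oriented M"
    define w where "w j = sgn (m 0) * m j" for j
    have pos: "w j > 0" if "j \<le> d" for j
    proof -
      have "w j = \<bar>m j\<bar>" using or that unfolding o w_def
        by (metis abs_sgn le0 mult.commute)
      then show ?thesis using or that unfolding o by simp
    qed
    have wker: "in_kernel M d w"
      using mker unfolding in_kernel_def w_def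
      by (simp add: mult.left_commute flip: sum_distrib_left)
    have "\<exists>t. \<forall>j\<le>d. \<mu> j = t * w j" if \<mu>: "in_kernel M d \<mu>" for \<mu>
    proof -
      define t where "t = \<mu> 0 / w 0"
      define \<nu> where "\<nu> j = \<mu> j - t * w j" for j
      have "in_kernel M d \<nu>"
        using \<mu> wker unfolding in_kernel_def \<nu>_def
        by (simp add: right_diff_distrib sum_subtractf mult.left_commute flip: sum_distrib_left)
      moreover have "\<nu> 0 = 0" using pos[of 0] by (simp add: \<nu>_def t_def)
      moreover have "minor M (Suc 0) \<noteq> 0" using or nz[of 0] unfolding o by blast
      ultimately have "\<forall>j\<le>d. \<nu> j = 0" using minor_nz_iff[OF M, of 0] by blast
      then show ?thesis by (auto simp: \<nu>_def)
    qed
    then show "\<exists>w. (\<forall>j\<le>d. w j > 0) \<and> in_kernel M d w \<and>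
      (\<forall>\<mu>. in_kernel M d \<mu> \<longrightarrow> (\<exists>t. \<forall>j\<le>d. \<mu> j = t * w j))"
      using pos wker by blast
  next
    assume "\<exists>w. (\<forall>j\<le>d. w j > 0) \<and> in_kernel M d w \<and>
      (\<forall>\<mu>. in_kernel M d \<mu> \<longrightarrow> (\<exists>t. \<forall>j\<le>d. \<mu> j = t * w j))"
    then obtain w where w: "\<And>j. j \<le> d \<Longrightarrow> w j > 0"
      "\<And>\<mu>. in_kernel M d \<mu> \<Longrightarrow> \<exists>t. \<forall>j\<le>d. \<mu> j = t * w j" by blast
    have mnz: "m k \<noteq> 0" if k: "k \<le> d" for k
      unfolding nz minor_nz_iff[OF M k]
    proof (intro allI impI)
      fix \<mu> j assume \<mu>: "\<mu> k = 0 \<and> in_kernel M d \<mu>" and j: "j \<le> d"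
      then obtain t where t: "\<forall>j\<le>d. \<mu> j = t * w j" using w(2) by blast
      then have "t = 0" using \<mu> k w(1)[of k] by fastforce
      then show "\<mu> j = 0" using t j by simp
    qed
    obtain t where t: "\<forall>j\<le>d. m j = t * w j" using w(2)[OF mker] by blast
    have "sgn (m k) = sgn t" if "k \<le> d" for k
      using t that w(1)[OF that] by (simp add: sgn_mult)
    then show "oriented M" unfolding o using mnz by auto
  qed
qed

lemma bij_betw_pick:
  assumes "finite I" "card I = Suc d"
  shows "bij_betw (pick I) {..d} I"
proof -
  have "inj_on (pick I) {..d}"
  proof (rule linorder_inj_onI)
    show "x < y \<Longrightarrow> x \<in> {..d} \<Longrightarrow> y \<in> {..d} \<Longrightarrow> pick I x \<noteq> pick I y" for x y
      using pick_mono_le[of y I x] assms by fastforce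
  qed auto
  moreover have "pick I ` {..d} \<subseteq> I"
    using assms by (auto intro!: pick_in_set_le)
  ultimately show ?thesis
    using assms by (simp add: bij_betw_def card_subset_eq card_image)
qed

text \<open>
  The map h numbers the coordinates by the rows of the matrix.
\<close>

definition column_vec :: "('d::finite \<Rightarrow> nat) \<Rightarrow> real mat \<Rightarrow> nat \<Rightarrow> real ^ 'd" where
  "column_vec h C j = (\<chi> i. C $$ (h i, j))"

lemma oriented_submatrix_iff:
  fixes h :: "'d::finite \<Rightarrow> nat"
  assumes h: "bij_betw h UNIV {..<CARD('d)}" and C: "C \<in> carrier_mat CARD('d) n"
    and I: "I \<subseteq> {..<n}" "card I = CARD('d) + 1"
  shows "oriented (submatrix C UNIV I) \<longleftrightarrow>
    (\<exists>w. (\<forall>j\<in>I. w j > 0) \<and> (\<Sum>j\<in>I. w j *\<^sub>R column_vec h C j) = 0 \<and>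
      (\<forall>\<mu>. (\<Sum>j\<in>I. \<mu> j *\<^sub>R column_vec h C j) = 0 \<longrightarrow> (\<exists>t. \<forall>j\<in>I. \<mu> j = t * w j)))"
    (is "_ \<longleftrightarrow> ?R")
proof -
  let ?d = "CARD('d)" and ?M = "submatrix C UNIV I"
  have fin: "finite I" using I finite_subset by blast
  have bij: "bij_betw (pick I) {..?d} I" using bij_betw_pick[OF fin] I by simp
  have cols: "{j. j < dim_col C \<and> j \<in> I} = I" using C I by auto
  have M: "?M \<in> carrier_mat ?d (Suc ?d)"
    unfolding carrier_mat_def dim_submatrix mem_Collect_eq cols using C I by simp
  have entry: "?M $$ (r, j) = C $$ (r, pick I j)" if "r < ?d" "j \<le> ?d" for r j
    using submatrix_index[of r C UNIV j I] that C I cols by (simp add: pick_UNIV)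
  have ker: "in_kernel ?M ?d (\<mu> \<circ> pick I) \<longleftrightarrow> (\<Sum>j\<in>I. \<mu> j *\<^sub>R column_vec h C j) = 0" for \<mu>
  proof -
    have "(\<Sum>j\<le>?d. ?M $$ (r, j) * (\<mu> \<circ> pick I) j) = (\<Sum>j\<in>I. C $$ (r, j) * \<mu> j)" if "r < ?d" for r
      using sum.reindex_bij_betw[OF bij, of "\<lambda>j. C $$ (r, j) * \<mu> j"] entry[OF that]
      by simp
    then have "in_kernel ?M ?d (\<mu> \<circ> pick I) \<longleftrightarrow> (\<forall>r\<in>range h. (\<Sum>j\<in>I. C $$ (r, j) * \<mu> j) = 0)"
      unfolding in_kernel_def bij_betw_imp_surj_on[OF h] by auto
    also have "\<dots> \<longleftrightarrow> (\<Sum>j\<in>I. \<mu> j *\<^sub>R column_vec h C j) = 0"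
      by (simp add: Finite_Cartesian_Product.vec_eq_iff column_vec_def mult.commute)
    finally show ?thesis .
  qed
  have ball: "(\<forall>j\<le>?d. P (pick I j)) \<longleftrightarrow> (\<forall>j\<in>I. P j)" for P
  proof -
    have "(\<forall>j\<le>?d. P (pick I j)) \<longleftrightarrow> (\<forall>j\<in>pick I ` {..?d}. P j)" by auto
    then show ?thesis unfolding bij_betw_imp_surj_on[OF bij] .
  qed
  define g where "g = the_inv_into {..?d} (pick I)"
  have g: "g (pick I j) = j" if "j \<le> ?d" for j
    unfolding g_def using the_inv_into_f_f bij that by (metis atMost_iff bij_betw_def)
  have kercong: "in_kernel ?M ?d \<mu> \<longleftrightarrow> in_kernel ?M ?d ((\<mu> \<circ> g) \<circ> pick I)" for \<mu>
    unfolding in_kernel_def using g by simp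
  show ?thesis
    unfolding oriented_iff_kernel[OF M]
  proof
    assume "\<exists>w. (\<forall>j\<le>?d. w j > 0) \<and> in_kernel ?M ?d w \<and>
      (\<forall>\<mu>. in_kernel ?M ?d \<mu> \<longrightarrow> (\<exists>t. \<forall>j\<le>?d. \<mu> j = t * w j))"
    then obtain w where w: "\<forall>j\<le>?d. w j > 0" "in_kernel ?M ?d w"
      "\<And>\<mu>. in_kernel ?M ?d \<mu> \<Longrightarrow> \<exists>t. \<forall>j\<le>?d. \<mu> j = t * w j" by blast
    have "\<forall>j\<in>I. (w \<circ> g) j > 0" unfolding ball[symmetric] using w(1) g by simp
    moreover have "(\<Sum>j\<in>I. (w \<circ> g) j *\<^sub>R column_vec h C j) = 0"
      using w(2) unfolding kercong[of w] ker .
    moreover have "\<exists>t. \<forall>j\<in>I. \<mu> j = t * (w \<circ> g) j" if "(\<Sum>j\<in>I. \<mu> j *\<^sub>R column_vec h C j) = 0" for \<mu>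
      unfolding ball[symmetric] using w(3)[of "\<mu> \<circ> pick I"] that g unfolding ker by simp
    ultimately show ?R by blast
  next
    assume ?R
    then obtain w where w: "\<forall>j\<in>I. w j > 0" "(\<Sum>j\<in>I. w j *\<^sub>R column_vec h C j) = 0"
      "\<And>\<mu>. (\<Sum>j\<in>I. \<mu> j *\<^sub>R column_vec h C j) = 0 \<Longrightarrow> \<exists>t. \<forall>j\<in>I. \<mu> j = t * w j" by blast
    have "\<forall>j\<le>?d. (w \<circ> pick I) j > 0" using w(1) unfolding ball[symmetric] by simp
    moreover have "in_kernel ?M ?d (w \<circ> pick I)" using w(2) unfolding ker .
    moreover have "\<exists>t. \<forall>j\<le>?d. \<mu> j = t * (w \<circ> pick I) j" if "in_kernel ?M ?d \<mu>" for \<mu>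
    proof -
      have "\<exists>t. \<forall>j\<in>I. (\<mu> \<circ> g) j = t * w j"
        using that unfolding kercong[of \<mu>] ker by (rule w(3))
      then show ?thesis unfolding ball[symmetric] using g by simp
    qed
    ultimately show "\<exists>w. (\<forall>j\<le>?d. w j > 0) \<and> in_kernel ?M ?d w \<and>
      (\<forall>\<mu>. in_kernel ?M ?d \<mu> \<longrightarrow> (\<exists>t. \<forall>j\<le>?d. \<mu> j = t * w j))" by blast
  qed
qed

section \<open>Frames of the cells of a simplicial complex\<close>

lemma convex_hull_affine_independent_eq_iff:
  fixes V W :: "'a::euclidean_space set"
  assumes "\<not> affine_dependent V" "\<not> affine_dependent W"
  shows "convex hull V = convex hull W \<longleftrightarrow> V = W"
  using extreme_point_of_convex_hull_affine_independent[OF assms(1)]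
    extreme_point_of_convex_hull_affine_independent[OF assms(2)] by auto

lemma simplicial_complex_face:
  assumes "simplicial_complex \<Gamma>" "convex hull V \<in> \<Gamma>" "\<not> affine_dependent V" "U \<subseteq> V"
  shows "convex hull U \<in> \<Gamma>"
  using assms face_of_convex_hull_affine_independent[of V "convex hull U"]
  unfolding simplicial_complex_def by blast

text \<open>
  Both vertex sets see the intersection as a face, and a simplex determines its vertices as its
  extreme points.
\<close>

lemma simplicial_complex_Int:
  assumes \<Gamma>: "simplicial_complex \<Gamma>" and V: "convex hull V \<in> \<Gamma>" "\<not> affine_dependent V"
    and W: "convex hull W \<in> \<Gamma>" "\<not> affine_dependent W"
  shows "convex hull V \<inter> convex hull W = convex hull (V \<inter> W)"
proof -
  have "(convex hull V \<inter> convex hull W) face_of convex hull V"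
    "(convex hull W \<inter> convex hull V) face_of convex hull W"
    using \<Gamma> V W unfolding simplicial_complex_def by blast+
  then obtain U U' where U: "U \<subseteq> V" "convex hull V \<inter> convex hull W = convex hull U"
    and U': "U' \<subseteq> W" "convex hull V \<inter> convex hull W = convex hull U'"
    using face_of_convex_hull_affine_independent V(2) W(2) by (metis Int_commute)
  have "U = U'"
    using convex_hull_affine_independent_eq_iff[of U U'] U U' V(2) W(2) affine_independent_subset by metis
  then have "convex hull V \<inter> convex hull W \<subseteq> convex hull (V \<inter> W)"
    using U U' by (metis Int_greatest hull_mono)
  then show ?thesis by (meson Int_greatest hull_mono inf_le1 inf_le2 subset_antisym)
qed

lemma card_range_frame:
  fixes e :: "'d::finite option \<Rightarrow> real ^ 'd"
  assumes "frame_det e \<noteq> 0"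
  shows "card (range e) = CARD('d) + 1"
  using assms card_image[of e UNIV] by (simp add: frame_det_nz_iff_affine_independent card_UNIV_option)

lemma simplex_iff_frame:
  fixes S :: "(real ^ 'd) set"
  shows "int CARD('d) simplex S \<longleftrightarrow> (\<exists>e. frame_det e \<noteq> 0 \<and> S = convex hull (range e))"
proof
  assume "int CARD('d) simplex S"
  then obtain V where V: "\<not> affine_dependent V" "card V = CARD('d) + 1" "S = convex hull V"
    unfolding simplex_def by auto
  then have "finite V" using aff_independent_finite by blast
  then obtain e where "bij_betw e (UNIV :: 'd option set) V"
    using finite_same_card_bij[of "UNIV :: 'd option set" V] V(2) by (auto simp: card_UNIV_option)
  then show "\<exists>e. frame_det e \<noteq> 0 \<and> S = convex hull (range e)"
    using V unfolding frame_det_nz_iff_affine_independent bij_betw_def by auto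
next
  assume "\<exists>e. frame_det e \<noteq> 0 \<and> S = convex hull (range e)"
  then show "int CARD('d) simplex S"
    using card_range_frame frame_det_nz_iff_affine_independent unfolding simplex_def by fastforce
qed

lemma range_frame_upd: "range (e(k := q)) = insert q (e ` (-{k}))"
  by (auto simp: fun_upd_image Compl_eq_Diff_UNIV)

text \<open>
  In a simplicial complex the intersection of two adjacent simplices is their common facet, as
  the flip lemma requires.
\<close>

lemma simplicial_complex_frame_flip:
  fixes e :: "'d::finite option \<Rightarrow> real ^ 'd"
  assumes \<Gamma>: "simplicial_complex \<Gamma>" and S: "convex hull (range e) \<in> \<Gamma>" "frame_det e \<noteq> 0"
    and T: "convex hull (range (e(k := q))) \<in> \<Gamma>" "frame_det (e(k := q)) \<noteq> 0"
    and ne: "convex hull (range e) \<noteq> convex hull (range (e(k := q)))"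
  shows "frame_det (e(k := q)) * frame_det e < 0"
proof (rule frame_det_flip[OF S(2) T(2)])
  let ?V = "range e" and ?W = "range (e(k := q))"
  have ind: "inj e" "\<not> affine_dependent ?V" "\<not> affine_dependent ?W"
    using S T frame_det_nz_iff_affine_independent by blast+
  have "q \<notin> ?V"
  proof
    assume "q \<in> ?V"
    then have "?W \<subseteq> ?V" unfolding range_frame_upd by auto
    then have "?W = ?V" using card_range_frame[OF S(2)] card_range_frame[OF T(2)]
      by (intro card_subset_eq) auto
    then show False using ne by simp
  qed
  then have "?V \<inter> ?W \<subseteq> e ` (-{k})" unfolding range_frame_upd by auto
  then show "convex hull ?V \<inter> convex hull ?W \<subseteq> convex hull (e ` (-{k}))"
    using simplicial_complex_Int[OF \<Gamma> S(1) ind(2) T(1) ind(3)] by (simp add: hull_mono)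
qed

text \<open>
  Adjacency of cells is the exchange of one vertex; exchanging it in place keeps the enumeration
  of the others, which makes determinants comparable.
\<close>

lemma common_facet_frame:
  fixes e :: "'d::finite option \<Rightarrow> real ^ 'd"
  assumes S: "S = convex hull (range e)" "frame_det e \<noteq> 0" and T: "int CARD('d) simplex T"
    and F: "F facet_of S" "F facet_of T"
  obtains k q where "T = convex hull (range (e(k := q)))" "frame_det (e(k := q)) \<noteq> 0"
proof -
  obtain e' where e': "frame_det e' \<noteq> 0" "T = convex hull (range e')"
    using T simplex_iff_frame by blast
  have ind: "inj e" "\<not> affine_dependent (range e)" "\<not> affine_dependent (range e')"
    using S e' frame_det_nz_iff_affine_independent by blast+
  obtain W W' where W: "W \<subseteq> range e" "F = convex hull W" and W': "W' \<subseteq> range e'" "F = convex hull W'"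
    using F S e' ind unfolding facet_of_def by (metis face_of_convex_hull_affine_independent)
  have indW: "\<not> affine_dependent W" "\<not> affine_dependent W'"
    using W W' ind affine_independent_subset by blast+
  then have WW': "W = W'" using W W' convex_hull_affine_independent_eq_iff by metis
  have "aff_dim S = int CARD('d)"
    using aff_dim_simplex simplex_iff_frame S by blast
  then have "aff_dim F = int CARD('d) - 1" using F(1) unfolding facet_of_def by simp
  then have cW: "card W = CARD('d)"
    using aff_dim_affine_independent[OF indW(1)] W(2) by (simp add: aff_dim_convex_hull)
  define K where "K = e -` W"
  have K: "W = e ` K" using W(1) unfolding K_def by auto
  then have "card K = CARD('d)" using cW card_image[of e K] ind(1) inj_on_subset by (metis subset_UNIV)
  then have "card (- K) = 1" by (simp add: Compl_eq_Diff_UNIV card_Diff_subset card_UNIV_option)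
  then obtain k where "- K = {k}" using card_1_singletonE by blast
  then have Kk: "K = -{k}" by (metis double_compl)
  have finW: "finite W" using indW aff_independent_finite by blast
  have "card (range e' - W) = 1"
    using card_Diff_subset[OF finW, of "range e'"] W'(1) WW' card_range_frame[OF e'(1)] cW by simp
  then obtain q where q: "range e' - W = {q}" using card_1_singletonE by blast
  then have r: "range e' = range (e(k := q))"
    unfolding range_frame_upd using K Kk W'(1) WW' by auto
  have "q \<notin> e ` (-{k})" using q K Kk by auto
  then have "inj (e(k := q))" using ind(1) by (auto simp: inj_on_def)
  then have "frame_det (e(k := q)) \<noteq> 0"
    unfolding frame_det_nz_iff_affine_independent r[symmetric] using ind(3) by blast
  with that e'(2) r show ?thesis by metis
qed

lemma frame_upd_common_facet:
  fixes e :: "'d::finite option \<Rightarrow> real ^ 'd"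
  assumes "frame_det e \<noteq> 0" "frame_det (e(k := q)) \<noteq> 0"
  shows "convex hull (e ` (-{k})) facet_of convex hull (range e)"
    and "convex hull (e ` (-{k})) facet_of convex hull (range (e(k := q)))"
proof -
  have *: "convex hull (e ` (-{k})) facet_of convex hull (range e)"
    if "frame_det e \<noteq> 0" for e :: "'d option \<Rightarrow> real ^ 'd"
  proof -
    have ind: "inj e" "\<not> affine_dependent (range e)"
      using that frame_det_nz_iff_affine_independent by blast+
    have ind': "\<not> affine_dependent (e ` (-{k}))"
      by (rule affine_independent_subset[OF ind(2)]) auto
    have "card (e ` (-{k})) = CARD('d)"
      using card_image[of e "-{k}"] ind(1) inj_on_subset[of e UNIV "-{k}"]
      by (simp add: Compl_eq_Diff_UNIV card_UNIV_option)
    then have "aff_dim (e ` (-{k})) = int CARD('d) - 1" "e ` (-{k}) \<noteq> {}"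
      using aff_dim_affine_independent[OF ind'] by auto
    moreover have "aff_dim (range e) = int CARD('d)"
      using aff_dim_affine_independent[OF ind(2)] card_range_frame[OF that] by simp
    moreover have "convex hull (e ` (-{k})) face_of convex hull (range e)"
      using face_of_convex_hull_affine_independent[OF ind(2)] by (metis image_mono top_greatest)
    ultimately show ?thesis unfolding facet_of_def by (simp add: aff_dim_convex_hull)
  qed
  show "convex hull (e ` (-{k})) facet_of convex hull (range e)" using * assms by blast
  have "(e(k := q)) ` (-{k}) = e ` (-{k})" by auto
  then show "convex hull (e ` (-{k})) facet_of convex hull (range (e(k := q)))"
    using *[OF assms(2)] by simp
qed

lemma simplex_vertices_subset:
  assumes "triangulates \<Gamma> A" "convex hull V \<in> \<Gamma>" "\<not> affine_dependent V"
  shows "V \<subseteq> A"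
proof
  fix v assume "v \<in> V"
  then have "convex hull {v} \<in> \<Gamma>"
    using assms simplicial_complex_face[of \<Gamma> V "{v}"] unfolding triangulates_def by blast
  then show "v \<in> A" using assms(1) unfolding triangulates_def by auto
qed

section \<open>From balanced to decorated\<close>

text \<open>
  A linear combination of the standard basis vectors and minus their sum vanishes iff all its
  coefficients are equal.
\<close>

lemma balanced_imp_decorated:
  fixes a :: "nat \<Rightarrow> real ^ 'd"
  assumes inj: "inj_on a {..<n}" and tri: "triangulates \<Gamma> (a ` {..<n})"
    and bal: "balanced (a ` {..<n}) CARD('d) \<Gamma>"
  obtains C where "C \<in> carrier_mat CARD('d) n"
    "\<And>S. S \<in> \<Gamma> \<Longrightarrow> int CARD('d) simplex S \<Longrightarrow> positively_decorates C a S"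
proof -
  let ?d = "CARD('d)"
  have \<Gamma>: "simplicial_complex \<Gamma>" using tri triangulates_def by blast
  obtain \<gamma> where \<gamma>: "\<gamma> ` (a ` {..<n}) \<subseteq> {1..?d + 1}"
    "\<And>x y. x \<in> a ` {..<n} \<Longrightarrow> y \<in> a ` {..<n} \<Longrightarrow> x \<noteq> y \<Longrightarrow> convex hull {x, y} \<in> \<Gamma> \<Longrightarrow> \<gamma> x \<noteq> \<gamma> y"
  proof -
    obtain \<gamma> where "\<gamma> ` (a ` {..<n}) \<subseteq> {1..?d + 1} \<and> (\<forall>x\<in>a ` {..<n}. \<forall>y\<in>a ` {..<n}.
        x \<noteq> y \<and> convex hull {x, y} \<in> \<Gamma> \<longrightarrow> \<gamma> x \<noteq> \<gamma> y)"
      using bal unfolding balanced_def by (rule exE)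
    then show ?thesis by (intro that[of \<gamma>]) (simp, metis)
  qed
  obtain h :: "'d \<Rightarrow> nat" where h: "bij_betw h UNIV {..<?d}"
    using finite_same_card_bij[of "UNIV :: 'd set" "{..<?d}"] by auto
  \<comment> \<open>Column k of w is the k-th standard basis vector, and column d + 1 is minus their sum.\<close>
  define w where "w k r = (if k = r + 1 then 1 else if k = ?d + 1 then -1 else (0::real))" for k r
  define C where "C = mat ?d n (\<lambda>(r, j). w (\<gamma> (a j)) r)"
  have C: "C \<in> carrier_mat ?d n" by (simp add: C_def)
  have wsum: "(\<Sum>k\<in>{1..?d + 1}. x k * w k r) = x (r + 1) - x (?d + 1)" if "r < ?d" for x r
  proof -
    have "(\<Sum>k\<in>{1..?d + 1}. x k * w k r)
      = (\<Sum>k\<in>{1..?d + 1}. (if k = r + 1 then x k else 0) - (if k = ?d + 1 then x k else 0))"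
      by (rule sum.cong) (use that in \<open>auto simp: w_def\<close>)
    also have "\<dots> = x (r + 1) - x (?d + 1)"
      unfolding sum_subtractf using that by simp
    finally show ?thesis .
  qed
  have "positively_decorates C a S" if S: "S \<in> \<Gamma>" "int ?d simplex S" for S
  proof -
    obtain V where V: "\<not> affine_dependent V" "card V = ?d + 1" "S = convex hull V"
      using S(2) unfolding simplex_def by auto
    have VA: "V \<subseteq> a ` {..<n}" using simplex_vertices_subset[OF tri] S V by blast
    define I where "I = {j. j < n \<and> a j \<in> V}"
    have aI: "bij_betw a I V"
      unfolding bij_betw_def
    proof
      show "inj_on a I" using inj by (rule inj_on_subset) (auto simp: I_def)
      show "a ` I = V" using VA by (auto simp: I_def)
    qed
    have cI: "card I = ?d + 1" using bij_betw_same_card[OF aI] V(2) by simp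
    have "inj_on \<gamma> V"
    proof (rule inj_onI, rule ccontr)
      fix x y assume xy: "x \<in> V" "y \<in> V" "\<gamma> x = \<gamma> y" "x \<noteq> y"
      have "convex hull {x, y} \<in> \<Gamma>"
        using simplicial_complex_face[OF \<Gamma>, of V "{x, y}"] S V xy by blast
      then show False using \<gamma>(2) xy VA by blast
    qed
    then have "inj_on (\<gamma> \<circ> a) I" using aI by (auto simp: bij_betw_def comp_inj_on)
    moreover have "(\<gamma> \<circ> a) ` I \<subseteq> {1..?d + 1}" using \<gamma>(1) by (auto simp: I_def)
    ultimately have g: "bij_betw (\<gamma> \<circ> a) I {1..?d + 1}"
      unfolding bij_betw_def
      by (intro conjI card_subset_eq) (use cI card_image[of "\<gamma> \<circ> a" I] in auto)
    define f where "f = the_inv_into I (\<gamma> \<circ> a)"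
    have f: "f (\<gamma> (a j)) = j" if "j \<in> I" for j
      using g that the_inv_into_f_f[of "\<gamma> \<circ> a" I j] by (simp add: f_def bij_betw_def)
    have row: "(\<Sum>j\<in>I. \<mu> j * w (\<gamma> (a j)) r) = \<mu> (f (r + 1)) - \<mu> (f (?d + 1))" if "r < ?d" for \<mu> r
    proof -
      have "(\<Sum>j\<in>I. \<mu> j * w (\<gamma> (a j)) r) = (\<Sum>j\<in>I. (\<mu> \<circ> f) ((\<gamma> \<circ> a) j) * w ((\<gamma> \<circ> a) j) r)"
        using f by simp
      also have "\<dots> = (\<Sum>k\<in>{1..?d + 1}. (\<mu> \<circ> f) k * w k r)"
        using sum.reindex_bij_betw[OF g, of "\<lambda>k. (\<mu> \<circ> f) k * w k r"] .
      finally show ?thesis unfolding wsum[OF that] by simp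
    qed
    have In: "I \<subseteq> {..<n}" by (auto simp: I_def)
    have hd: "h i < ?d" for i using h by (auto simp: bij_betw_def)
    have ker: "(\<Sum>j\<in>I. \<mu> j *\<^sub>R column_vec h C j) = 0 \<longleftrightarrow> (\<forall>i. \<mu> (f (h i + 1)) = \<mu> (f (?d + 1)))" for \<mu>
    proof -
      have "(\<Sum>j\<in>I. \<mu> j *\<^sub>R column_vec h C j) = 0 \<longleftrightarrow> (\<forall>i. (\<Sum>j\<in>I. \<mu> j * w (\<gamma> (a j)) (h i)) = 0)"
      proof -
        have "vec_nth (\<Sum>j\<in>I. \<mu> j *\<^sub>R column_vec h C j) i = (\<Sum>j\<in>I. \<mu> j * w (\<gamma> (a j)) (h i))" for i
          unfolding sum_component
          by (rule sum.cong) (use hd In in \<open>auto simp: column_vec_def C_def\<close>)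
        then show ?thesis by (simp add: Finite_Cartesian_Product.vec_eq_iff)
      qed
      also have "\<dots> \<longleftrightarrow> (\<forall>i. \<mu> (f (h i + 1)) = \<mu> (f (?d + 1)))"
        unfolding row[OF hd] by simp
      finally show ?thesis .
    qed
    have "oriented (submatrix C UNIV I)"
      unfolding oriented_submatrix_iff[OF h C In cI]
    proof (intro exI[of _ "\<lambda>_. 1"] conjI allI impI)
      show "(\<Sum>j\<in>I. 1 *\<^sub>R column_vec h C j) = 0" using ker[of "\<lambda>_. 1"] by simp
      fix \<mu> assume "(\<Sum>j\<in>I. \<mu> j *\<^sub>R column_vec h C j) = 0"
      then have m: "\<mu> (f (h i + 1)) = \<mu> (f (?d + 1))" for i unfolding ker by blast
      show "\<exists>t. \<forall>j\<in>I. \<mu> j = t * 1"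
      proof (intro exI ballI)
        fix j assume j: "j \<in> I"
        define k where "k = \<gamma> (a j)"
        have k: "k \<in> {1..?d + 1}" using g j by (auto simp: bij_betw_def k_def)
        have "\<mu> (f k) = \<mu> (f (?d + 1))"
        proof (cases "k = ?d + 1")
          case False
          then have "k - 1 \<in> range h" using k bij_betw_imp_surj_on[OF h] by auto
          then obtain i where "k - 1 = h i" by blast
          then have "h i + 1 = k" using k by (cases k) auto
          then show ?thesis using m by metis
        qed simp
        then show "\<mu> j = \<mu> (f (?d + 1)) * 1" using f[OF j] by (simp add: k_def)
      qed
    qed auto
    then show ?thesis
      unfolding positively_decorates_def using C In cI V(3) aI
      by (intro exI[of _ I]) (auto simp: bij_betw_def)
  qed
  with C that show ?thesis by blast
qed

section \<open>From decorated to bipartite\<close>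

text \<open>
  A reordering multiplies both determinants by the sign of the same permutation.
\<close>

lemma frame_det_prod_reindex:
  fixes \<iota> \<iota>' :: "'d::finite option \<Rightarrow> 'i" and a c :: "'i \<Rightarrow> real ^ 'd"
  assumes "inj \<iota>" "inj \<iota>'" "range \<iota> = range \<iota>'"
  shows "frame_det (a \<circ> \<iota>') * frame_det (c \<circ> \<iota>') = frame_det (a \<circ> \<iota>) * frame_det (c \<circ> \<iota>)"
proof -
  define p where "p = inv_into UNIV \<iota> \<circ> \<iota>'"
  have \<iota>': "\<iota>' = \<iota> \<circ> p"
    unfolding p_def using assms(3) by (auto simp: fun_eq_iff f_inv_into_f)
  then have "inj p" using assms(2) by (metis inj_on_imageI2)
  then have "bij p" by (simp add: bij_def finite_UNIV_inj_surj)
  then have p: "p permutes UNIV" by (intro bij_imp_permutes) auto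
  have s: "of_int (sign p) * of_int (sign p) = (1::real)" by (metis of_int_1 of_int_mult sign_idempotent)
  have "frame_det (a \<circ> \<iota>') * frame_det (c \<circ> \<iota>')
    = (of_int (sign p) * of_int (sign p)) * (frame_det (a \<circ> \<iota>) * frame_det (c \<circ> \<iota>))"
    unfolding \<iota>' comp_assoc[symmetric] frame_det_permute[OF p] by (simp add: mult_ac)
  then show ?thesis unfolding s by simp
qed

text \<open>
  The columns that decorate a simplex are themselves the vertices of a simplex with the origin
  in its interior; the weights w are the barycentric coordinates of the origin.
\<close>

lemma decorated_imp_positive_frame:
  fixes a :: "nat \<Rightarrow> real ^ 'd" and h :: "'d \<Rightarrow> nat"
  assumes inj: "inj_on a {..<n}" and h: "bij_betw h UNIV {..<CARD('d)}"
    and C: "C \<in> carrier_mat CARD('d) n" and dec: "positively_decorates C a (convex hull (a ` range \<iota>))"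
    and \<iota>: "range \<iota> \<subseteq> {..<n}" "frame_det (a \<circ> \<iota>) \<noteq> 0"
  shows "frame_det (column_vec h C \<circ> \<iota>) \<noteq> 0"
    and "\<exists>w. (\<forall>k. w k > 0) \<and> sum w UNIV = 1 \<and> (\<Sum>k\<in>UNIV. w k *\<^sub>R column_vec h C (\<iota> k)) = 0"
proof -
  let ?d = "CARD('d)" and ?c = "column_vec h C"
  obtain I where I: "I \<subseteq> {..<n}" "card I = ?d + 1" "convex hull (a ` range \<iota>) = convex hull (a ` I)"
    "oriented (submatrix C UNIV I)"
    using dec C unfolding positively_decorates_def by auto
  have ind: "inj (a \<circ> \<iota>)" "\<not> affine_dependent (a ` range \<iota>)"
    using \<iota>(2) frame_det_nz_iff_affine_independent by (metis image_comp)+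
  have finI: "finite I" using I finite_subset by blast
  have injI: "inj_on a I" using inj I inj_on_subset by blast
  have "aff_dim (a ` I) = aff_dim (a ` range \<iota>)" using I(3) by (metis aff_dim_convex_hull)
  also have "\<dots> = int ?d"
    using aff_dim_affine_independent[OF ind(2)] card_range_frame[OF \<iota>(2)] by (simp add: image_comp)
  finally have "\<not> affine_dependent (a ` I)"
    unfolding affine_independent_iff_card using finI I card_image[OF injI] by simp
  then have "a ` range \<iota> = a ` I" using I(3) ind(2) convex_hull_affine_independent_eq_iff by blast
  then have rI: "range \<iota> = I" using inj_on_image_eq_iff[OF inj \<iota>(1) I(1)] by blast
  have inj\<iota>: "inj \<iota>" using ind(1) by (metis inj_on_imageI2)
  have sum: "(\<Sum>j\<in>I. f j) = (\<Sum>k\<in>UNIV. f (\<iota> k))" for f :: "nat \<Rightarrow> 'z::comm_monoid_add"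
    unfolding rI[symmetric] by (simp add: sum.reindex[OF inj\<iota>])
  obtain w where w: "\<forall>j\<in>I. w j > 0" "(\<Sum>j\<in>I. w j *\<^sub>R ?c j) = 0"
    "\<And>\<mu>. (\<Sum>j\<in>I. \<mu> j *\<^sub>R ?c j) = 0 \<Longrightarrow> \<exists>t. \<forall>j\<in>I. \<mu> j = t * w j"
    using I(4) unfolding oriented_submatrix_iff[OF h C I(1,2)] by blast
  have wpos: "w (\<iota> k) > 0" for k using w(1) rI by blast
  define s where "s = (\<Sum>k\<in>UNIV. w (\<iota> k))"
  have s: "s > 0" unfolding s_def by (rule sum_pos) (use wpos in auto)
  show "frame_det (?c \<circ> \<iota>) \<noteq> 0"
    unfolding frame_det_nz_iff
  proof (intro allI impI)
    fix \<mu> :: "'d option \<Rightarrow> real" and k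
    assume \<mu>: "sum \<mu> UNIV = 0 \<and> (\<Sum>k\<in>UNIV. \<mu> k *\<^sub>R (?c \<circ> \<iota>) k) = 0"
    define f where "f = inv_into UNIV \<iota>"
    have f: "f (\<iota> k) = k" for k using inj\<iota> by (simp add: f_def)
    have "(\<Sum>j\<in>I. (\<mu> \<circ> f) j *\<^sub>R ?c j) = 0" unfolding sum using \<mu> f by simp
    then obtain t where t: "\<And>j. j \<in> I \<Longrightarrow> (\<mu> \<circ> f) j = t * w j" using w(3) by blast
    have mt: "\<mu> k = t * w (\<iota> k)" for k using t[of "\<iota> k"] f rI by auto
    have "sum \<mu> UNIV = t * s" unfolding s_def sum_distrib_left by (rule sum.cong) (auto simp: mt)
    then have "t = 0" using \<mu> s by simp
    then show "\<mu> k = 0" using mt by simp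
  qed
  show "\<exists>w. (\<forall>k. w k > 0) \<and> sum w UNIV = 1 \<and> (\<Sum>k\<in>UNIV. w k *\<^sub>R ?c (\<iota> k)) = 0"
  proof (intro exI[of _ "\<lambda>k. w (\<iota> k) / s"] conjI allI)
    show "w (\<iota> k) / s > 0" for k using wpos s by simp
    show "(\<Sum>k\<in>UNIV. w (\<iota> k) / s) = 1" using s unfolding sum_divide_distrib[symmetric] s_def[symmetric] by simp
    have "(\<Sum>k\<in>UNIV. (w (\<iota> k) / s) *\<^sub>R ?c (\<iota> k)) = (1 / s) *\<^sub>R (\<Sum>k\<in>UNIV. w (\<iota> k) *\<^sub>R ?c (\<iota> k))"
      by (simp add: scaleR_sum_right)
    also have "\<dots> = 0" using w(2) unfolding sum by simp
    finally show "(\<Sum>k\<in>UNIV. (w (\<iota> k) / s) *\<^sub>R ?c (\<iota> k)) = 0" .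
  qed
qed

lemma decorated_imp_bipartite:
  fixes a :: "nat \<Rightarrow> real ^ 'd"
  assumes inj: "inj_on a {..<n}" and tri: "triangulates \<Gamma> (a ` {..<n})"
    and C: "C \<in> carrier_mat CARD('d) n"
    and dec: "\<And>S. S \<in> \<Gamma> \<Longrightarrow> int CARD('d) simplex S \<Longrightarrow> positively_decorates C a S"
  shows "bipartite (dual_graph CARD('d) \<Gamma>)"
proof -
  let ?d = "CARD('d)"
  have \<Gamma>: "simplicial_complex \<Gamma>" using tri triangulates_def by blast
  obtain h :: "'d \<Rightarrow> nat" where h: "bij_betw h UNIV {..<?d}"
    using finite_same_card_bij[of "UNIV :: 'd set" "{..<?d}"] by auto
  define c where "c = column_vec h C"
  define enum where "enum S \<iota> \<longleftrightarrow> range \<iota> \<subseteq> {..<n} \<and> frame_det (a \<circ> \<iota>) \<noteq> 0 \<and>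
    S = convex hull (range (a \<circ> \<iota>))" for S and \<iota> :: "'d option \<Rightarrow> nat"
  define pos where "pos S \<longleftrightarrow> (\<exists>\<iota>. enum S \<iota> \<and> frame_det (a \<circ> \<iota>) * frame_det (c \<circ> \<iota>) > 0)" for S
  have pos_iff: "pos S \<longleftrightarrow> frame_det (a \<circ> \<iota>) * frame_det (c \<circ> \<iota>) > 0" if en: "enum S \<iota>" for S \<iota>
  proof -
    have "frame_det (a \<circ> \<iota>') * frame_det (c \<circ> \<iota>') = frame_det (a \<circ> \<iota>) * frame_det (c \<circ> \<iota>)"
      if en': "enum S \<iota>'" for \<iota>'
    proof (rule frame_det_prod_reindex)
      have fr: "inj (a \<circ> \<iota>)" "inj (a \<circ> \<iota>')" "\<not> affine_dependent (range (a \<circ> \<iota>))"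
        "\<not> affine_dependent (range (a \<circ> \<iota>'))"
        using en en' frame_det_nz_iff_affine_independent unfolding enum_def by blast+
      show "inj \<iota>" "inj \<iota>'" using fr by (metis inj_on_imageI2)+
      have "range (a \<circ> \<iota>) = range (a \<circ> \<iota>')"
        using convex_hull_affine_independent_eq_iff fr(3,4) en en' unfolding enum_def by metis
      then show "range \<iota> = range \<iota>'"
        using inj_on_image_eq_iff[OF inj] en en' unfolding enum_def by (metis image_comp)
    qed
    then show ?thesis using en unfolding pos_def by metis
  qed
  have enum_ex: "\<exists>\<iota>. enum S \<iota>" if S: "S \<in> \<Gamma>" "int ?d simplex S" for S
  proof -
    obtain e where e: "frame_det e \<noteq> 0" "S = convex hull (range e)" using S simplex_iff_frame by blast
    then have "range e \<subseteq> a ` {..<n}"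
      using simplex_vertices_subset[OF tri] S frame_det_nz_iff_affine_independent by blast
    then have "\<forall>k. \<exists>j<n. e k = a j" by fastforce
    then obtain \<iota> where "\<forall>k. \<iota> k < n \<and> e k = a (\<iota> k)" by metis
    then have "range \<iota> \<subseteq> {..<n}" "a \<circ> \<iota> = e" by auto
    then show ?thesis using e unfolding enum_def by blast
  qed
  have flip: "pos S \<longleftrightarrow> \<not> pos T"
    if S: "S \<in> \<Gamma>" "int ?d simplex S" and T: "T \<in> \<Gamma>" "int ?d simplex T" and ne: "S \<noteq> T"
      and F: "F facet_of S" "F facet_of T" for S T F
  proof -
    obtain \<iota> where \<iota>: "enum S \<iota>" using enum_ex S by blast
    obtain k q where q: "T = convex hull (range ((a \<circ> \<iota>)(k := q)))" "frame_det ((a \<circ> \<iota>)(k := q)) \<noteq> 0"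
      using common_facet_frame[OF _ _ T(2) F] \<iota> unfolding enum_def by metis
    have "range ((a \<circ> \<iota>)(k := q)) \<subseteq> a ` {..<n}"
      using simplex_vertices_subset[OF tri] T q frame_det_nz_iff_affine_independent by blast
    then obtain m where m: "m < n" "q = a m" by (auto simp: range_frame_upd)
    define \<iota>' where "\<iota>' = \<iota>(k := m)"
    have a\<iota>': "a \<circ> \<iota>' = (a \<circ> \<iota>)(k := q)" by (auto simp: \<iota>'_def m)
    have \<iota>': "enum T \<iota>'" unfolding enum_def a\<iota>' using q \<iota> m by (auto simp: enum_def \<iota>'_def)
    have fa: "frame_det (a \<circ> \<iota>') * frame_det (a \<circ> \<iota>) < 0"
      unfolding a\<iota>'
      by (rule simplicial_complex_frame_flip[OF \<Gamma>]) (use \<iota> q S T ne in \<open>auto simp: enum_def\<close>)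
    have dS: "positively_decorates C a (convex hull (a ` range \<iota>))"
      and dT: "positively_decorates C a (convex hull (a ` range \<iota>'))"
      using dec S T \<iota> \<iota>' unfolding enum_def by (metis image_comp)+
    have e1: "range \<iota> \<subseteq> {..<n}" "frame_det (a \<circ> \<iota>) \<noteq> 0" and e2: "range \<iota>' \<subseteq> {..<n}" "frame_det (a \<circ> \<iota>') \<noteq> 0"
      using \<iota> \<iota>' unfolding enum_def by auto
    note D1 = decorated_imp_positive_frame[OF inj h C dS e1, folded c_def]
    note D2 = decorated_imp_positive_frame[OF inj h C dT e2, folded c_def]
    obtain w where w: "\<And>k. w k > 0" "sum w UNIV = 1" "(\<Sum>k\<in>UNIV. w k *\<^sub>R (c \<circ> \<iota>) k) = 0"
      using D1(2) by auto
    obtain w' where w': "\<And>k. w' k > 0" "sum w' UNIV = 1" "(\<Sum>k\<in>UNIV. w' k *\<^sub>R (c \<circ> \<iota>') k) = 0"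
      using D2(2) by auto
    \<comment> \<open>With the origin in place k the two column frames coincide, so Cramer's rule compares their signs.\<close>
    have "(c \<circ> \<iota>')(k := 0) = (c \<circ> \<iota>)(k := 0)" by (auto simp: \<iota>'_def)
    then have wc: "w k * frame_det (c \<circ> \<iota>) = w' k * frame_det (c \<circ> \<iota>')"
      using frame_det_cramer[OF w(2,3), of k] frame_det_cramer[OF w'(2,3), of k] by metis
    define r where "r = w' k / w k"
    have fc: "frame_det (c \<circ> \<iota>) = r * frame_det (c \<circ> \<iota>')" and r: "r > 0"
      using w(1)[of k] w'(1)[of k] wc unfolding r_def by (simp_all add: field_simps)
    have "frame_det (c \<circ> \<iota>') \<noteq> 0" using D2(1) .
    then show ?thesis
      unfolding pos_iff[OF \<iota>] pos_iff[OF \<iota>'] fc using fa r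
      by (auto simp: zero_less_mult_iff mult_less_0_iff)
  qed
  let ?V = "{S \<in> \<Gamma>. int ?d simplex S}"
  show ?thesis
    unfolding bipartite_def dual_graph_def fst_conv snd_conv
  proof (intro exI conjI ballI)
    show "{S \<in> ?V. pos S} \<union> {S \<in> ?V. \<not> pos S} = ?V" "{S \<in> ?V. pos S} \<inter> {S \<in> ?V. \<not> pos S} = {}" by auto
    fix E assume "E \<in> {{S, T} |S T. S \<in> \<Gamma> \<and> T \<in> \<Gamma> \<and> int ?d simplex S \<and> int ?d simplex T \<and> S \<noteq> T \<and>
         (\<exists>F. F facet_of S \<and> F facet_of T)}"
    then obtain S T F where ST: "E = {S, T}" "S \<in> \<Gamma>" "T \<in> \<Gamma>" "int ?d simplex S" "int ?d simplex T" "S \<noteq> T"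
      "F facet_of S" "F facet_of T" by blast
    then have fl: "pos S \<longleftrightarrow> \<not> pos T" using flip by blast
    show "\<exists>x\<in>{S \<in> ?V. pos S}. \<exists>y\<in>{S \<in> ?V. \<not> pos S}. E = {x, y}"
    proof (cases "pos S")
      case True
      then show ?thesis using ST fl by blast
    next
      case False
      then have "pos T" "E = {T, S}" using fl ST(1) by (auto simp: insert_commute)
      then show ?thesis using ST False by blast
    qed
  qed
qed

section \<open>Generic points of convex sets\<close>

text \<open>
  A line through a point outside an affine set meets that set at most once, so the segment from
  a point outside the earlier sets to one outside the new set has only finitely many bad
  parameters.
\<close>

lemma convex_avoids_affine_sets:
  fixes C :: "'a::euclidean_space set"
  assumes "finite \<H>" "convex C" "C \<noteq> {}" "\<And>H. H \<in> \<H> \<Longrightarrow> affine H" "\<And>H. H \<in> \<H> \<Longrightarrow> \<not> C \<subseteq> H"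
  shows "\<exists>x\<in>C. \<forall>H\<in>\<H>. x \<notin> H"
  using assms
proof (induction \<H> rule: finite_induct)
  case (insert H \<H>)
  then obtain x where x: "x \<in> C" "\<forall>H\<in>\<H>. x \<notin> H" by auto
  obtain y where y: "y \<in> C" "y \<notin> H" using insert.prems by blast
  let ?p = "\<lambda>t. (1 - t) *\<^sub>R x + t *\<^sub>R y"
  have one: "finite {t. ?p t \<in> G}" if G: "affine G" and xy: "x \<notin> G \<or> y \<notin> G" for G
  proof -
    have "s = t" if s: "?p s \<in> G" and t: "?p t \<in> G" for s t
    proof (rule ccontr)
      assume st: "s \<noteq> t"
      have "?p u \<in> G" for u
      proof -
        define r where "r = (u - s) / (t - s)"
        have "r * (t - s) = u - s" using st by (simp add: r_def)
        then have u: "u = (1 - r) * s + r * t" by (simp add: algebra_simps)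
        have "(1 - r) *\<^sub>R ?p s + r *\<^sub>R ?p t \<in> G" using G s t by (simp add: affine_alt)
        also have "(1 - r) *\<^sub>R ?p s + r *\<^sub>R ?p t = ?p u"
          unfolding u by (simp add: algebra_simps)
        finally show ?thesis .
      qed
      from this[of 0] this[of 1] have "x \<in> G" "y \<in> G" by auto
      with xy show False by blast
    qed
    then have "{t. ?p t \<in> G} \<subseteq> {SOME t. ?p t \<in> G}" by (auto intro: someI2)
    then show ?thesis using finite_subset by blast
  qed
  have "finite (\<Union>G\<in>insert H \<H>. {t. ?p t \<in> G})"
  proof (rule finite_UN_I)
    show "finite (insert H \<H>)" using insert.hyps by simp
    show "finite {t. ?p t \<in> G}" if "G \<in> insert H \<H>" for G
      using that x y insert.prems(3) by (intro one) auto
  qed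
  moreover have "infinite {0..1::real}" by (simp add: infinite_Icc)
  ultimately obtain t where t: "t \<in> {0..1}" "t \<notin> (\<Union>G\<in>insert H \<H>. {t. ?p t \<in> G})"
    by (meson finite_subset subsetI)
  then have "?p t \<in> C" using insert.prems(1) x y by (auto simp: convex_alt)
  then show ?case using t by blast
qed auto

text \<open>
  A contraction towards v moves any point of C into the ball.
\<close>

lemma convex_ball_subset_affine:
  fixes C :: "'a::euclidean_space set"
  assumes C: "convex C" "v \<in> C" and r: "r > 0" and H: "affine H" "C \<inter> ball v r \<subseteq> H"
  shows "C \<subseteq> H"
proof
  fix w assume w: "w \<in> C"
  define \<eta> where "\<eta> = r / (r + norm (w - v) + 1)"
  have den: "r + norm (w - v) + 1 > 0" using r by (simp add: add_pos_nonneg)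
  have \<eta>: "0 < \<eta>" "\<eta> < 1" using r den by (auto simp: \<eta>_def field_simps add_pos_nonneg)
  have "\<eta> * norm (w - v) < r"
  proof -
    have "r * norm (w - v) < r * (r + norm (w - v) + 1)" using r by (intro mult_strict_left_mono) auto
    then show ?thesis using den by (simp add: \<eta>_def pos_divide_less_eq)
  qed
  then have "(1 - \<eta>) *\<^sub>R v + \<eta> *\<^sub>R w \<in> ball v r"
    using \<eta> by (simp add: dist_norm norm_minus_commute algebra_simps flip: scaleR_diff_right)
  moreover have "(1 - \<eta>) *\<^sub>R v + \<eta> *\<^sub>R w \<in> C" using C w \<eta> by (auto simp: convex_alt)
  ultimately have q: "(1 - \<eta>) *\<^sub>R v + \<eta> *\<^sub>R w \<in> H" using H by blast
  have vH: "v \<in> H" using C r H by auto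
  have "(1 - 1 / \<eta>) *\<^sub>R v + (1 / \<eta>) *\<^sub>R ((1 - \<eta>) *\<^sub>R v + \<eta> *\<^sub>R w) \<in> H"
    using H(1) vH q by (simp only: affine_alt)
  also have "(1 - 1 / \<eta>) *\<^sub>R v + (1 / \<eta>) *\<^sub>R ((1 - \<eta>) *\<^sub>R v + \<eta> *\<^sub>R w) = w"
  proof -
    have q: "(1 - \<eta>) *\<^sub>R v + \<eta> *\<^sub>R w = v + \<eta> *\<^sub>R (w - v)" by (simp add: algebra_simps)
    show ?thesis unfolding q using \<eta>(1) by (simp add: scaleR_add_right scaleR_left_diff_distrib)
  qed
  finally show "w \<in> H" .
qed

lemma ball_disjoint_closed:
  fixes p :: "'a::metric_space"
  assumes "closed B" "p \<notin> B"
  obtains r where "r > 0" "ball p r \<inter> B = {}"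
proof -
  have "open (- B)" "p \<in> - B" using assms by auto
  then obtain r where "r > 0" "ball p r \<subseteq> - B" using open_contains_ball by blast
  then show ?thesis using that by blast
qed

lemma range_comp_transpose: "range (e \<circ> Transposition.transpose i j) = range e"
proof -
  have "surj (Transposition.transpose i j)" by (rule surjI[of _ "Transposition.transpose i j"]) simp
  then show ?thesis unfolding image_comp[symmetric] by simp
qed

section \<open>Colourings compatible with the signs\<close>

text \<open>
  The sign function encodes the bipartition of the dual graph.
\<close>

locale alternating_complex =
  fixes \<Gamma> :: "(real ^ 'd) set set" and \<epsilon> :: "(real ^ 'd) set \<Rightarrow> real"
  assumes complex: "simplicial_complex \<Gamma>"
    and convex_space: "convex (\<Union>\<Gamma>)"
    and full_dim: "aff_dim (\<Union>\<Gamma>) = int CARD('d)"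
    and sign_cases: "\<epsilon> S = 1 \<or> \<epsilon> S = -1"
    and alternating: "\<lbrakk>S \<in> \<Gamma>; T \<in> \<Gamma>; int CARD('d) simplex S; int CARD('d) simplex T; S \<noteq> T;
      F facet_of S; F facet_of T\<rbrakk> \<Longrightarrow> \<epsilon> S \<noteq> \<epsilon> T"
begin

abbreviation space :: "(real ^ 'd) set" where "space \<equiv> \<Union>\<Gamma>"

definition cells :: "(real ^ 'd) set set" where
  "cells = {S \<in> \<Gamma>. int CARD('d) simplex S}"

text \<open>
  A colouring is encoded as the map from the colours to the vertices. The condition on the sign
  admits exactly one of the two colourings that differ by a transposition.
\<close>

definition coloring :: "(real ^ 'd) set \<Rightarrow> ('d option \<Rightarrow> real ^ 'd) \<Rightarrow> bool" where
  "coloring S e \<longleftrightarrow> S \<in> \<Gamma> \<and> S = convex hull (range e) \<and> sgn (frame_det e) = \<epsilon> S"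

text \<open>
  Colours are compared at common vertices only, as the two simplices may share any face or none.
\<close>

definition agree :: "('d option \<Rightarrow> real ^ 'd) \<Rightarrow> ('d option \<Rightarrow> real ^ 'd) \<Rightarrow> bool" where
  "agree e e' \<longleftrightarrow> (\<forall>k l. e k = e' l \<longrightarrow> k = l)"

text \<open>
  Faces are measured by their number of vertices, which is one more than their dimension.
\<close>

definition avoids :: "nat \<Rightarrow> (real ^ 'd) set \<Rightarrow> bool" where
  "avoids m A \<longleftrightarrow> (\<forall>U. \<not> affine_dependent U \<and> convex hull U \<in> \<Gamma> \<and> card U < m \<longrightarrow> convex hull U \<inter> A = {})"

text \<open>
  A tame set meets only faces of codimension at most two. In dimensions one and two every set is
  tame.
\<close>

abbreviation tame :: "(real ^ 'd) set \<Rightarrow> bool" where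
  "tame \<equiv> avoids (CARD('d) - 1)"

text \<open>
  The case of equal simplices makes every simplex that meets the set coloured.
\<close>

definition coherent :: "(real ^ 'd) set \<Rightarrow> ((real ^ 'd) set \<Rightarrow> 'd option \<Rightarrow> real ^ 'd) \<Rightarrow> bool" where
  "coherent A f \<longleftrightarrow> (\<forall>S\<in>cells. \<forall>T\<in>cells. S \<inter> T \<inter> A \<noteq> {} \<longrightarrow>
    coloring S (f S) \<and> agree (f S) (f T))"

lemma finite_cells: "finite cells"
  using complex unfolding cells_def simplicial_complex_def by simp

lemma coloring_frame:
  assumes "coloring S e"
  shows "frame_det e \<noteq> 0" "inj e" "\<not> affine_dependent (range e)" "S = convex hull (range e)" "S \<in> cells"
proof -
  show nz: "frame_det e \<noteq> 0" using assms sign_cases[of S] unfolding coloring_def by auto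
  then show "inj e" "\<not> affine_dependent (range e)" using frame_det_nz_iff_affine_independent by blast+
  show "S = convex hull (range e)" using assms unfolding coloring_def by blast
  then show "S \<in> cells" using assms nz simplex_iff_frame unfolding coloring_def cells_def by blast
qed

lemma cell_props:
  assumes "T \<in> cells"
  shows "T \<in> \<Gamma>" "convex T" "compact T" "closed T" "T \<noteq> {}" "aff_dim T = int CARD('d)" "T \<subseteq> \<Union>\<Gamma>"
proof -
  have T: "T \<in> \<Gamma>" "int CARD('d) simplex T" using assms by (auto simp: cells_def)
  then show "T \<in> \<Gamma>" "T \<subseteq> \<Union>\<Gamma>" by auto
  show "convex T" using T(2) convex_simplex by blast
  show "compact T" using T(2) compact_simplex by blast
  then show "closed T" by (rule compact_imp_closed)
  show "aff_dim T = int CARD('d)" using T(2) aff_dim_simplex by blast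
  then show "T \<noteq> {}" by auto
qed

lemma cell_frame:
  assumes "T \<in> cells"
  obtains e where "frame_det e \<noteq> 0" "inj e" "\<not> affine_dependent (range e)" "T = convex hull (range e)"
  using assms simplex_iff_frame frame_det_nz_iff_affine_independent unfolding cells_def by blast

lemma agree_refl: "coloring S e \<Longrightarrow> agree e e"
  using coloring_frame(2) unfolding agree_def by (metis injD)

lemma agree_same_cell:
  assumes "coloring T e" "coloring T e'" "agree e e'"
  shows "e = e'"
proof
  fix k
  have "range e = range e'"
    using convex_hull_affine_independent_eq_iff coloring_frame(3,4) assms(1,2) by metis
  then obtain l where "e k = e' l" by blast
  then show "e k = e' k" using assms(3) unfolding agree_def by metis
qed

text \<open>
  Suppose that a common vertex has the colour i in one simplex and j in the other. All other
  colours belong to equal vertices, and interchanging i and j in the second colouring reverses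
  its orientation. If the simplices are equal, this gives two colourings of equal vertices with
  opposite orientations. If they are different, the interchanged colouring arises from the first
  one by exchanging a single vertex, so its orientation is opposite by the flip lemma, whereas
  the signs of the two simplices are opposite as well: a contradiction again.
\<close>

lemma agree_if_equal_on_codim2:
  assumes S: "coloring S e" and T: "coloring T e'" and K: "CARD('d) \<le> card {k. e k = e' k} + 1"
  shows "agree e e'"
  unfolding agree_def
proof (intro allI impI, rule ccontr)
  fix i j assume ij: "e i = e' j" "i \<noteq> j"
  note eS = coloring_frame[OF S] and eT = coloring_frame[OF T]
  let ?K = "{k. e k = e' k}"
  have iK: "i \<notin> ?K" "j \<notin> ?K" using ij eS(2) eT(2) by (metis (mono_tags, lifting) injD mem_Collect_eq)+
  have eqK: "e k = e' k" if "k \<noteq> i" "k \<noteq> j" for k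
  proof (rule ccontr)
    assume "e k \<noteq> e' k"
    then have "card (insert i (insert j (insert k ?K))) = card ?K + 3" using iK ij that by simp
    then show False using card_mono[OF finite subset_UNIV, of "insert i (insert j (insert k ?K))"] K
      by (simp add: card_UNIV_option)
  qed
  define e'' where "e'' = e' \<circ> Transposition.transpose i j"
  have e'': "e'' = e(j := e' i)"
  proof
    fix x show "e'' x = (e(j := e' i)) x"
      using ij eqK[of x] by (cases "x = j"; cases "x = i") (auto simp: e''_def)
  qed
  have D: "frame_det e'' = - frame_det e'" unfolding e''_def by (rule frame_det_swap[OF ij(2)])
  have r: "range e'' = range e'"
    unfolding e''_def by (rule range_comp_transpose)
  have sgns: "sgn (frame_det e) = \<epsilon> S" "sgn (frame_det e') = \<epsilon> T"
    using S T unfolding coloring_def by blast+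
  have nz: "frame_det (e(j := e' i)) \<noteq> 0" using D eT(1) unfolding e'' by simp
  show False
  proof (cases "S = T")
    case True
    then have "range e = range e'"
      using convex_hull_affine_independent_eq_iff eS(3,4) eT(3,4) by metis
    then obtain l where l: "e' i = e l" by blast
    have "l = j"
    proof (rule ccontr)
      assume "l \<noteq> j"
      then have "e'' l = e'' j" using l unfolding e'' by simp
      moreover have "inj e''" using nz frame_det_nz_iff_affine_independent unfolding e'' by blast
      ultimately show False using \<open>l \<noteq> j\<close> by (auto dest: injD)
    qed
    then have "e'' = e" using l unfolding e'' by simp
    then have "sgn (frame_det e) = - sgn (frame_det e')" using D by simp
    then have "\<epsilon> T = - \<epsilon> T" using sgns True by simp
    then show False using sign_cases[of T] by auto
  next
    case False
    have TT: "T = convex hull (range (e(j := e' i)))" using eT(4) r unfolding e'' by simp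
    have "frame_det (e(j := e' i)) * frame_det e < 0"
    proof (rule simplicial_complex_frame_flip[OF complex _ eS(1) _ nz])
      show "convex hull (range e) \<in> \<Gamma>" using S unfolding coloring_def by metis
      show "convex hull (range (e(j := e' i))) \<in> \<Gamma>" using T TT unfolding coloring_def by metis
      show "convex hull (range e) \<noteq> convex hull (range (e(j := e' i)))" using False TT eS(4) by metis
    qed
    then have "sgn (frame_det e) = sgn (frame_det e')"
      using D unfolding e'' by (auto simp: mult_less_0_iff sgn_if zero_less_mult_iff)
    then have "\<epsilon> S = \<epsilon> T" using sgns by simp
    moreover have "\<epsilon> S \<noteq> \<epsilon> T"
    proof (rule alternating)
      show "convex hull (e ` (-{j})) facet_of S" "convex hull (e ` (-{j})) facet_of T"
        using frame_upd_common_facet[OF eS(1) nz] TT eS(4) by metis+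
    qed (use eS(5) eT(5) False in \<open>auto simp: cells_def\<close>)
    ultimately show False by blast
  qed
qed

lemma coloring_swap:
  assumes "T \<in> cells" "T = convex hull (range e)" "i \<noteq> j" "inj e"
  shows "coloring T e \<or> coloring T (e \<circ> Transposition.transpose i j)"
proof -
  have "frame_det e \<noteq> 0"
  proof -
    obtain e' where e': "inj e'" "\<not> affine_dependent (range e')" "T = convex hull (range e')" "frame_det e' \<noteq> 0"
      using cell_frame[OF assms(1)] by metis
    have "aff_dim (range e) = int CARD('d)" using cell_props(6)[OF assms(1)] assms(2) by (simp add: aff_dim_convex_hull)
    moreover have "card (range e) = CARD('d) + 1" using card_image[OF assms(4)] by (simp add: card_UNIV_option)
    ultimately have "\<not> affine_dependent (range e)" unfolding affine_independent_iff_card by simp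
    then show ?thesis using assms(4) frame_det_nz_iff_affine_independent by blast
  qed
  then have "sgn (frame_det e) = 1 \<or> sgn (frame_det e) = -1" by (auto simp: sgn_if)
  moreover have "range (e \<circ> Transposition.transpose i j) = range e"
    by (rule range_comp_transpose)
  ultimately show ?thesis
    using assms frame_det_swap[OF assms(3), of e] sign_cases[of T] unfolding coloring_def cells_def by auto
qed

text \<open>
  The two remaining colours can be distributed in two ways, one of each orientation.
\<close>

lemma coloring_extend:
  fixes e0 :: "'d option \<Rightarrow> real ^ 'd"
  assumes S: "coloring S e" and T: "T = convex hull (range e0)" "T \<in> cells" "inj e0"
    and U: "U \<subseteq> range e" "U \<subseteq> range e0" "card U + 1 = CARD('d)"
  obtains e' where "coloring T e'" "\<And>k. e k \<in> U \<Longrightarrow> e' k = e k"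
proof -
  define K where "K = {k. e k \<in> U}"
  have U': "U = e ` K" using U(1) by (auto simp: K_def)
  have injK: "inj_on e K" using coloring_frame(2)[OF S] inj_on_subset by blast
  then have cK: "card K = card U" using U' card_image by metis
  then have cK2: "card (-K) = 2" using U(3) by (simp add: Compl_eq_Diff_UNIV card_Diff_subset card_UNIV_option)
  have "card (range e0 - U) = 2"
    using U card_image[OF T(3)] finite_subset[OF U(2)] by (simp add: card_Diff_subset card_UNIV_option)
  then obtain g where g: "bij_betw g (-K) (range e0 - U)"
    using finite_same_card_bij[of "-K" "range e0 - U"] cK2 by auto
  define e1 where "e1 k = (if k \<in> K then e k else g k)" for k
  have "bij_betw e1 K U"
    using injK U' by (auto simp: bij_betw_def e1_def inj_on_def)
  moreover have "bij_betw e1 (-K) (range e0 - U)"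
    using g by (rule bij_betw_cong[THEN iffD1, rotated]) (simp add: e1_def)
  ultimately have "bij_betw e1 (K \<union> -K) (U \<union> (range e0 - U))"
    by (rule bij_betw_combine) auto
  then have e1: "inj e1" "range e1 = range e0" using U(2) by (auto simp: bij_betw_def Un_absorb1)
  obtain i j where ij: "-K = {i, j}" "i \<noteq> j" using cK2 by (meson card_2_iff)
  have "coloring T e1 \<or> coloring T (e1 \<circ> Transposition.transpose i j)"
    by (rule coloring_swap) (use T e1 ij in auto)
  moreover have "e1 k = e k" "(e1 \<circ> Transposition.transpose i j) k = e k" if "e k \<in> U" for k
  proof -
    have "k \<in> K" using that by (simp add: K_def)
    then have "k \<noteq> i" "k \<noteq> j" using ij(1) by auto
    then show "e1 k = e k" "(e1 \<circ> Transposition.transpose i j) k = e k" using \<open>k \<in> K\<close> by (auto simp: e1_def)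
  qed
  ultimately show ?thesis using that by blast
qed

text \<open>
  The smallest face that contains p is a face of every simplex that contains p.
\<close>

lemma tame_common_vertices:
  assumes p: "tame {p}" "T0 \<in> cells" "p \<in> T0"
  obtains W where "card W + 1 = CARD('d)"
    "\<And>V. \<not> affine_dependent V \<Longrightarrow> convex hull V \<in> \<Gamma> \<Longrightarrow> p \<in> convex hull V \<Longrightarrow> W \<subseteq> V"
proof -
  let ?P = "\<lambda>U. \<not> affine_dependent U \<and> convex hull U \<in> \<Gamma> \<and> p \<in> convex hull U"
  have "\<exists>U. ?P U" using cell_frame[OF p(2)] p(2,3) cell_props(1) by metis
  then obtain U where U: "?P U" "\<And>V. ?P V \<Longrightarrow> card U \<le> card V"
    using ex_has_least_nat[of ?P _ card] by metis
  have UV: "U \<subseteq> V" if V: "?P V" for V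
  proof -
    have "convex hull U \<inter> convex hull V = convex hull (U \<inter> V)"
      by (rule simplicial_complex_Int[OF complex]) (use U V in auto)
    then have "p \<in> convex hull (U \<inter> V)" using U V by blast
    moreover have "convex hull (U \<inter> V) \<in> \<Gamma>" by (rule simplicial_complex_face[OF complex, of U]) (use U in auto)
    moreover have "\<not> affine_dependent (U \<inter> V)" using U(1) affine_independent_subset by blast
    ultimately have "card U \<le> card (U \<inter> V)" using U(2) by blast
    moreover have "finite U" using U(1) aff_independent_finite by blast
    ultimately have "U \<inter> V = U" by (intro card_seteq) auto
    then show ?thesis by blast
  qed
  have "\<not> card U < CARD('d) - 1" using p(1) U(1) unfolding avoids_def by auto
  then obtain W where W: "W \<subseteq> U" "card W = CARD('d) - 1"
    using obtain_subset_with_card_n[of "CARD('d) - 1" U] by (metis not_less)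
  show ?thesis
  proof
    have "CARD('d) > 0" by simp
    then show "card W + 1 = CARD('d)" unfolding W(2) by linarith
    show "W \<subseteq> V" if "\<not> affine_dependent V" "convex hull V \<in> \<Gamma>" "p \<in> convex hull V" for V
      using W(1) UV that by blast
  qed
qed

text \<open>
  Agreement is not transitive in general; at a tame point it is, because there are common
  vertices enough to determine an admitted colouring.
\<close>

lemma agree_trans_at:
  assumes p: "tame {p}" "p \<in> S" "p \<in> T" "p \<in> T'"
    and c: "coloring S e" "coloring T e'" "coloring T' e''" and a: "agree e e'" "agree e e''"
  shows "agree e' e''"
proof (rule agree_if_equal_on_codim2[OF c(2,3)])
  note F = coloring_frame[OF c(1)] and F' = coloring_frame[OF c(2)] and F'' = coloring_frame[OF c(3)]
  obtain W where W: "card W + 1 = CARD('d)"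
    "\<And>V. \<not> affine_dependent V \<Longrightarrow> convex hull V \<in> \<Gamma> \<Longrightarrow> p \<in> convex hull V \<Longrightarrow> W \<subseteq> V"
    using tame_common_vertices[OF p(1) F(5) p(2)] by metis
  have sub: "W \<subseteq> range e" "W \<subseteq> range e'" "W \<subseteq> range e''"
    using W(2) F F' F'' p cell_props(1) by metis+
  have "W \<subseteq> e' ` {k. e' k = e'' k}"
  proof
    fix v assume "v \<in> W"
    then obtain k l m where "v = e k" "v = e' l" "v = e'' m" using sub by blast
    then show "v \<in> e' ` {k. e' k = e'' k}" using a unfolding agree_def by (metis (mono_tags, lifting) imageI mem_Collect_eq)
  qed
  then have "card W \<le> card {k. e' k = e'' k}" by (meson surj_card_le finite)
  then show "CARD('d) \<le> card {k. e' k = e'' k} + 1" using W(1) by simp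
qed

lemma transfer_coloring_ex:
  assumes p: "tame {p}" "p \<in> S" "p \<in> T" and S: "coloring S e" and T: "T \<in> cells"
  obtains e' where "coloring T e'" "agree e e'"
proof -
  note F = coloring_frame[OF S]
  obtain W where W: "card W + 1 = CARD('d)"
    "\<And>V. \<not> affine_dependent V \<Longrightarrow> convex hull V \<in> \<Gamma> \<Longrightarrow> p \<in> convex hull V \<Longrightarrow> W \<subseteq> V"
    using tame_common_vertices[OF p(1) F(5) p(2)] by metis
  obtain e0 where "frame_det e0 \<noteq> 0"
    and e0: "inj e0" "\<not> affine_dependent (range e0)" "T = convex hull (range e0)"
    by (rule cell_frame[OF T])
  have sub: "W \<subseteq> range e" "W \<subseteq> range e0"
    using W(2) F e0 T p cell_props(1) by metis+
  obtain e' where e': "coloring T e'" "\<And>k. e k \<in> W \<Longrightarrow> e' k = e k"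
    using coloring_extend[OF S e0(3) T e0(1) sub W(1)] by metis
  have "W \<subseteq> e ` {k. e k = e' k}"
  proof
    fix v assume "v \<in> W"
    moreover then obtain k where "v = e k" using sub by blast
    ultimately have "v = e k" "e k = e' k" using e'(2)[of k] by auto
    then show "v \<in> e ` {k. e k = e' k}" by (intro image_eqI[of _ _ k]) simp_all
  qed
  then have "card W \<le> card {k. e k = e' k}" by (meson surj_card_le finite)
  then have "agree e e'" using agree_if_equal_on_codim2[OF S e'(1)] W(1) by simp
  with e' that show ?thesis by blast
qed

definition transfer :: "('d option \<Rightarrow> real ^ 'd) \<Rightarrow> (real ^ 'd) set \<Rightarrow> 'd option \<Rightarrow> real ^ 'd" where
  "transfer e T = (SOME e'. coloring T e' \<and> agree e e')"

lemma transfer: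
  assumes "tame {p}" "p \<in> S" "p \<in> T" "coloring S e" "T \<in> cells"
  shows "coloring T (transfer e T)" "agree e (transfer e T)"
proof -
  obtain e' where "coloring T e' \<and> agree e e'" using transfer_coloring_ex[OF assms] by blast
  then have "coloring T (transfer e T) \<and> agree e (transfer e T)"
    unfolding transfer_def by (rule someI[where P = "\<lambda>e'. coloring T e' \<and> agree e e'"])
  then show "coloring T (transfer e T)" "agree e (transfer e T)" by auto
qed

lemma transfer_eq:
  assumes "tame {p}" "p \<in> S" "p \<in> T" "coloring S e" "coloring T e'" "agree e e'"
  shows "transfer e T = e'"
proof -
  note t = transfer[OF assms(1-4) coloring_frame(5)[OF assms(5)]]
  have "agree (transfer e T) e'"
    by (rule agree_trans_at[OF assms(1,2,3,3,4) t(1) assms(5) t(2) assms(6)])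
  then show ?thesis by (rule agree_same_cell[OF t(1) assms(5)])
qed

lemma tame_subset: "avoids m A \<Longrightarrow> B \<subseteq> A \<Longrightarrow> avoids m B"
  unfolding avoids_def by blast

lemma coherentD:
  assumes "coherent A f" "T \<in> cells" "p \<in> T" "p \<in> A"
  shows "coloring T (f T)" and "\<lbrakk>T' \<in> cells; p \<in> T'\<rbrakk> \<Longrightarrow> agree (f T) (f T')"
  using assms unfolding coherent_def by blast+

lemma coherent_mono:
  assumes "coherent A f" "\<And>S T. S \<in> cells \<Longrightarrow> T \<in> cells \<Longrightarrow> S \<inter> T \<inter> B \<noteq> {} \<Longrightarrow> S \<inter> T \<inter> A \<noteq> {}"
  shows "coherent B f"
  using assms unfolding coherent_def by meson

subsection \<open>Generic position and covering by cells\<close>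

lemma finite_faces: "finite {U. \<not> affine_dependent U \<and> convex hull U \<in> \<Gamma> \<and> P U}"
proof (rule finite_imageD[of "\<lambda>U. convex hull U"])
  show "finite ((\<lambda>U. convex hull U) ` {U. \<not> affine_dependent U \<and> convex hull U \<in> \<Gamma> \<and> P U})"
    by (rule finite_subset[of _ \<Gamma>]) (use complex in \<open>auto simp: simplicial_complex_def\<close>)
  show "inj_on (\<lambda>U. convex hull U) {U. \<not> affine_dependent U \<and> convex hull U \<in> \<Gamma> \<and> P U}"
    by (rule inj_onI) (simp add: convex_hull_affine_independent_eq_iff)
qed

text \<open>
  Two exceptional sets are allowed, since an intermediate point will have to be generic with
  respect to two given points.
\<close>

lemma generic_point:
  assumes C: "convex C" "C \<noteq> {}"
    and dim: "\<And>U. \<not> affine_dependent U \<Longrightarrow> convex hull U \<in> \<Gamma> \<Longrightarrow> card U < m \<Longrightarrow>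
      \<not> C \<subseteq> affine hull (U \<union> Z) \<and> \<not> C \<subseteq> affine hull (U \<union> Z')"
  obtains x where "x \<in> C"
    "\<And>U. \<not> affine_dependent U \<Longrightarrow> convex hull U \<in> \<Gamma> \<Longrightarrow> card U < m \<Longrightarrow>
      x \<notin> affine hull (U \<union> Z) \<and> x \<notin> affine hull (U \<union> Z')"
proof -
  let ?F = "{U. \<not> affine_dependent U \<and> convex hull U \<in> \<Gamma> \<and> card U < m}"
  let ?H = "(\<lambda>U. affine hull (U \<union> Z)) ` ?F \<union> (\<lambda>U. affine hull (U \<union> Z')) ` ?F"
  have "\<exists>x\<in>C. \<forall>H\<in>?H. x \<notin> H"
  proof (rule convex_avoids_affine_sets)
    show "finite ?H" using finite_faces by simp
    show "convex C" "C \<noteq> {}" using C .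
    show "affine H" if "H \<in> ?H" for H using that by auto
    show "\<not> C \<subseteq> H" if "H \<in> ?H" for H using that dim by blast
  qed
  then obtain x where x: "x \<in> C" "\<forall>H\<in>?H. x \<notin> H" by blast
  show ?thesis
  proof (rule that[OF x(1)])
    fix U assume "\<not> affine_dependent U" "convex hull U \<in> \<Gamma>" "card U < m"
    then have "U \<in> ?F" by simp
    then have "affine hull (U \<union> Z) \<in> ?H" "affine hull (U \<union> Z') \<in> ?H" by simp_all
    then show "x \<notin> affine hull (U \<union> Z) \<and> x \<notin> affine hull (U \<union> Z')" using x(2) by blast
  qed
qed

text \<open>
  A point of a face on the segment from z to a point of A, other than the latter, would put z
  into the affine hull of that face and A.
\<close>

lemma avoids_cone:
  assumes A: "avoids m A" "convex A" "A \<noteq> {}"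
    and z: "\<And>U. \<not> affine_dependent U \<Longrightarrow> convex hull U \<in> \<Gamma> \<Longrightarrow> card U < m \<Longrightarrow> z \<notin> affine hull (U \<union> A)"
  shows "avoids m (convex hull (insert z A))"
  unfolding avoids_def
proof (intro allI impI, rule ccontr)
  fix U assume U: "\<not> affine_dependent U \<and> convex hull U \<in> \<Gamma> \<and> card U < m"
    and "convex hull U \<inter> convex hull (insert z A) \<noteq> {}"
  then obtain y where y: "y \<in> convex hull U" "y \<in> convex hull (insert z A)" by blast
  have "convex hull A = A" using A(2) by (simp add: convex_hull_eq)
  then obtain a where a: "a \<in> A" "y \<in> closed_segment z a"
    using y(2) A(3) unfolding convex_hull_insert_segments by auto
  then obtain t where t: "0 \<le> t" "t \<le> 1" "y = (1 - t) *\<^sub>R z + t *\<^sub>R a"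
    unfolding closed_segment_def by blast
  have "y \<noteq> a" using A(1) U y a unfolding avoids_def by blast
  then have t1: "1 - t \<noteq> 0" using t by auto
  have ya: "y \<in> affine hull (U \<union> A)" "a \<in> affine hull (U \<union> A)"
    using y(1) convex_hull_subset_affine_hull[of U] hull_mono[of U "U \<union> A" affine] a(1)
    by (auto intro: hull_inc)
  define s where "s = 1 / (1 - t)"
  have "(1 - s) *\<^sub>R a + s *\<^sub>R y \<in> affine hull (U \<union> A)"
    using affine_affine_hull[of "U \<union> A"] ya by (simp only: affine_alt)
  also have "(1 - s) *\<^sub>R a + s *\<^sub>R y = z"
  proof -
    have e: "y = a + (1 - t) *\<^sub>R (z - a)" unfolding t(3) by (simp add: algebra_simps)
    have "s * (1 - t) = 1" using t1 by (simp add: s_def)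
    then have "s *\<^sub>R y = s *\<^sub>R a + (z - a)" unfolding e by (simp add: scaleR_add_right)
    then show ?thesis by (simp add: algebra_simps)
  qed
  finally show False using z U by blast
qed

lemma affine_hull_segment_subset:
  "affine hull (U \<union> closed_segment x z) \<subseteq> affine hull (U \<union> {x, z})"
proof (rule hull_minimal)
  have "closed_segment x z \<subseteq> affine hull {x, z}"
    using convex_hull_subset_affine_hull by (metis segment_convex_hull)
  then show "U \<union> closed_segment x z \<subseteq> affine hull (U \<union> {x, z})"
    using hull_mono[of "{x, z}" "U \<union> {x, z}" affine] hull_subset[of "U \<union> {x, z}" affine] by blast
qed simp

lemma not_subset_affine_hull:
  assumes "finite V" "int (card V) \<le> aff_dim C"
  shows "\<not> C \<subseteq> affine hull V"
proof
  assume "C \<subseteq> affine hull V"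
  then have "aff_dim C \<le> aff_dim V" by (metis aff_dim_subset aff_dim_affine_hull)
  also have "\<dots> \<le> int (card V) - 1" using aff_dim_le_card[OF assms(1)] .
  finally show False using assms(2) by simp
qed

text \<open>
  A neighbourhood of an uncovered point would be covered by finitely many simplices of lower
  dimension.
\<close>

lemma cells_cover: "\<Union>cells = space"
proof
  show "\<Union>cells \<subseteq> space" by (auto simp: cells_def)
  show "space \<subseteq> \<Union>cells"
  proof (rule subsetI, rule ccontr)
    fix p assume p: "p \<in> space" "p \<notin> \<Union>cells"
    have "closed (\<Union>cells)" using finite_cells cell_props(4) by blast
    then obtain r where r: "r > 0" "ball p r \<inter> \<Union>cells = {}"
      using ball_disjoint_closed p(2) by metis
    let ?C = "space \<inter> ball p r"
    obtain x where x: "x \<in> ?C"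
      "\<And>U. \<not> affine_dependent U \<Longrightarrow> convex hull U \<in> \<Gamma> \<Longrightarrow> card U < CARD('d) + 1 \<Longrightarrow> x \<notin> affine hull (U \<union> {})"
    proof (rule generic_point[of ?C "CARD('d) + 1" "{}" "{}"])
      show "convex ?C" using convex_space by (simp add: convex_Int)
      show "?C \<noteq> {}" using p r by auto
      show "\<not> ?C \<subseteq> affine hull (U \<union> {}) \<and> \<not> ?C \<subseteq> affine hull (U \<union> {})"
        if U: "\<not> affine_dependent U" "card U < CARD('d) + 1" for U
      proof -
        have "\<not> space \<subseteq> affine hull U"
          by (rule not_subset_affine_hull) (use U full_dim aff_independent_finite in auto)
        then show ?thesis using convex_ball_subset_affine[OF convex_space p(1) r(1), of "affine hull U"] by auto
      qed
    qed auto
    then obtain S where S: "S \<in> \<Gamma>" "x \<in> S" by blast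
    then obtain V n where V: "\<not> affine_dependent V" "S = convex hull V" "int (card V) = n + 1"
      using complex unfolding simplicial_complex_def simplex_def by blast
    have "x \<in> affine hull V" using S V convex_hull_subset_affine_hull by blast
    then have "CARD('d) + 1 \<le> card V" using x(2)[of V] V S by fastforce
    moreover have "int (card V) \<le> int CARD('d) + 1"
      using aff_dim_affine_independent[OF V(1)] aff_dim_le_DIM[of V] by simp
    ultimately have "int CARD('d) simplex S" unfolding simplex_def using V by (intro exI[of _ V]) auto
    then have "x \<in> \<Union>cells" using S by (auto simp: cells_def)
    then show False using r x by blast
  qed
qed

subsection \<open>Continuation along segments\<close>

text \<open>
  The parameter interval is traversed by bisection. Near a parameter t every simplex met by the
  segment contains the point p t, so all the simplices needed for a short extension are coloured
  by transfer from one simplex that is already coloured.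
\<close>

lemma coherent_along_segment:
  assumes seg: "x \<in> space" "z \<in> space" and tame: "tame (closed_segment x z)"
    and S: "coloring S e" "x \<in> S"
  obtains f where "coherent (closed_segment x z) f" "f S = e"
proof -
  define p where "p t = (1 - t) *\<^sub>R x + t *\<^sub>R z" for t
  have p: "p t \<in> closed_segment x z" if "0 \<le> t" "t \<le> 1" for t
    using that unfolding p_def closed_segment_def by auto
  have tame_p: "tame {p t}" if "0 \<le> t" "t \<le> 1" for t using tame_subset[OF tame] p[OF that] by blast
  have p_space: "p t \<in> space" if "0 \<le> t" "t \<le> 1" for t
    using that p_def seg convex_space by (auto simp: convex_alt)
  have p_between: "p t \<in> T" if T: "convex T" "p s \<in> T" "p r \<in> T" and str: "s \<le> t" "t \<le> r" for s t r T
  proof (cases "s = r")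
    case False
    define u where "u = (t - s) / (r - s)"
    have u: "0 \<le> u" "u \<le> 1" using str False by (auto simp: u_def field_simps)
    have "u * (r - s) = t - s" using False by (simp add: u_def)
    then have t: "t = (1 - u) * s + u * r" by (simp add: algebra_simps)
    have "(1 - u) *\<^sub>R p s + u *\<^sub>R p r \<in> T" using T u by (auto simp: convex_alt)
    also have "(1 - u) *\<^sub>R p s + u *\<^sub>R p r = p t" unfolding p_def t by (simp add: algebra_simps)
    finally show ?thesis .
  qed (use that in auto)
  have p_cont: "isCont p t" for t unfolding p_def by (intro continuous_intros)
  \<comment> \<open>A common family on the initial part of the segment up to t.\<close>
  define Q where "Q t \<longleftrightarrow> (\<exists>f. coherent (p ` {0..t}) f \<and> f S = e)" for t
  have p0: "p 0 = x" by (simp add: p_def)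
  have Q0: "Q 0"
    unfolding Q_def
  proof (intro exI conjI)
    have tx: "tame {x}" using tame_p[of 0] p0 by simp
    show "coherent (p ` {0..0}) (transfer e)"
      unfolding coherent_def
    proof (intro ballI impI)
      fix T T' assume T: "T \<in> cells" "T' \<in> cells" "T \<inter> T' \<inter> p ` {0..0} \<noteq> {}"
      then have xT: "x \<in> T" "x \<in> T'" using p0 by auto
      note t = transfer[OF tx S(2) xT(1) S(1) T(1)] and t' = transfer[OF tx S(2) xT(2) S(1) T(2)]
      show "coloring T (transfer e T) \<and> agree (transfer e T) (transfer e T')"
        using t(1) agree_trans_at[OF tx S(2) xT S(1) t(1) t'(1) t(2) t'(2)] by blast
    qed
    show "transfer e S = e"
      by (rule transfer_eq[OF tx S(2) S(2) S(1) S(1) agree_refl[OF S(1)]])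
  qed
  have local: "\<exists>\<delta>>0. \<forall>T\<in>cells. \<forall>r. \<bar>r - t\<bar> < \<delta> \<and> p r \<in> T \<longrightarrow> p t \<in> T" for t
  proof -
    let ?B = "\<Union>{T \<in> cells. p t \<notin> T}"
    have "closed ?B" using finite_cells cell_props(4) by (intro closed_Union) auto
    moreover have "p t \<in> - ?B" by blast
    ultimately have "\<forall>\<^sub>F r in at t. p r \<in> - ?B"
      using topological_tendstoD[OF isContD[OF p_cont], of "- ?B" t] open_Compl by blast
    then have "\<forall>\<^sub>F r in at t. p r \<notin> ?B" by (rule eventually_mono) blast
    then obtain \<delta> where "\<delta> > 0" "\<And>r. r \<noteq> t \<Longrightarrow> dist r t < \<delta> \<Longrightarrow> p r \<notin> ?B"
      unfolding eventually_at by blast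
    then have "p t \<in> T" if "T \<in> cells" "\<bar>r - t\<bar> < \<delta>" "p r \<in> T" for T r
      using that by (cases "r = t") (auto simp: dist_real_def)
    then show ?thesis using \<open>\<delta> > 0\<close> by blast
  qed
  \<comment> \<open>The bounds enter the predicate because the local step of the bisection ranges over all reals.\<close>
  have "0 \<le> (0::real) \<and> (1::real) \<le> 1 \<longrightarrow> Q 0 \<longrightarrow> Q 1"
  proof (rule Bolzano[of 0 1 "\<lambda>a b. 0 \<le> a \<and> b \<le> 1 \<longrightarrow> Q a \<longrightarrow> Q b"])
    fix t :: real
    assume t: "0 \<le> t" "t \<le> 1"
    obtain \<delta> where \<delta>: "\<delta> > 0" "\<And>T r. T \<in> cells \<Longrightarrow> \<bar>r - t\<bar> < \<delta> \<Longrightarrow> p r \<in> T \<Longrightarrow> p t \<in> T"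
      using local[of t] by blast
    have "Q b" if ab: "a \<le> t" "t \<le> b" "b - a < \<delta>" "0 \<le> a" "b \<le> 1" and Qa: "Q a" for a b
    proof -
      obtain f where f: "coherent (p ` {0..a}) f" "f S = e" using Qa unfolding Q_def by blast
      have "p a \<in> space" by (rule p_space) (use ab t in auto)
      then obtain T1 where T1: "T1 \<in> cells" "p a \<in> T1" using cells_cover by blast
      have pt1: "p t \<in> T1" using \<delta>(2)[OF T1(1) _ T1(2)] ab by simp
      have pa: "p a \<in> p ` {0..a}" using ab by simp
      note c1 = coherentD(1)[OF f(1) T1 pa]
      have tp: "tame {p t}" using tame_p t by blast
      define f' where "f' T = (if p t \<in> T then transfer (f T1) T else f T)" for T
      have f't: "coloring T (f' T)" "agree (f T1) (f' T)" if "T \<in> cells" "p t \<in> T" for T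
        using transfer[OF tp pt1 that(2) c1 that(1)] that by (auto simp: f'_def)
      have same: "f' T = f T" if T: "T \<in> cells" "p s \<in> T" "0 \<le> s" "s \<le> a" for T s
      proof (cases "p t \<in> T")
        case True
        have paT: "p a \<in> T"
          by (rule p_between[OF cell_props(2)[OF T(1)] T(2) True]) (use T ab in auto)
        have "f' T = transfer (f T1) T" using True by (simp add: f'_def)
        also have "\<dots> = f T"
          by (rule transfer_eq[OF tp pt1 True c1 coherentD(1)[OF f(1) T(1) paT pa]
                coherentD(2)[OF f(1) T1 pa T(1) paT]])
        finally show ?thesis .
      qed (simp add: f'_def)
      have "coherent (p ` {0..b}) f'"
        unfolding coherent_def
      proof (intro ballI impI)
        fix T T' assume T: "T \<in> cells" "T' \<in> cells" "T \<inter> T' \<inter> p ` {0..b} \<noteq> {}"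
        then obtain s where s: "0 \<le> s" "s \<le> b" "p s \<in> T" "p s \<in> T'" by auto
        show "coloring T (f' T) \<and> agree (f' T) (f' T')"
        proof (cases "s \<le> a")
          case True
          then have "p s \<in> p ` {0..a}" using s by simp
          then show ?thesis
            using same[OF T(1) s(3,1) True] same[OF T(2) s(4,1) True]
              coherentD[OF f(1) T(1) s(3)] T(2) s(4) by simp
        next
          case False
          then have "\<bar>s - t\<bar> < \<delta>" using ab s by simp
          then have pt: "p t \<in> T" "p t \<in> T'" using \<delta>(2) T s by blast+
          note g = f't[OF T(1) pt(1)] and g' = f't[OF T(2) pt(2)]
          show ?thesis
            using g(1) agree_trans_at[OF tp pt1 pt c1 g(1) g'(1) g(2) g'(2)] by blast
        qed
      qed
      moreover have "f' S = e"
        using same[OF coloring_frame(5)[OF S(1)], of 0] S(2) p0 f(2) ab by simp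
      ultimately show "Q b" unfolding Q_def by blast
    qed
    then show "\<exists>d>0. \<forall>a b. a \<le> t \<and> t \<le> b \<and> b - a < d \<longrightarrow> 0 \<le> a \<and> b \<le> 1 \<longrightarrow> Q a \<longrightarrow> Q b"
      using \<delta>(1) by blast
  qed auto
  then obtain f where "coherent (p ` {0..1}) f" "f S = e" using Q0 unfolding Q_def by auto
  moreover have "p ` {0..1} = closed_segment x z" unfolding p_def closed_segment_def by auto
  ultimately show ?thesis using that by simp
qed

text \<open>
  The simplices on which two coherent families are equal, and those on which they differ, give
  two closed sets that are disjoint on A.
\<close>

lemma coherent_unique:
  assumes f: "coherent A f" and g: "coherent A g"
    and A: "connected A" "tame A" "A \<subseteq> space"
    and S: "S \<in> cells" "S \<inter> A \<noteq> {}" "f S = g S" and T: "T \<in> cells" "T \<inter> A \<noteq> {}"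
  shows "f T = g T"
proof (rule ccontr)
  assume ne: "f T \<noteq> g T"
  let ?C = "\<Union>{T \<in> cells. f T = g T}" and ?E = "\<Union>{T \<in> cells. f T \<noteq> g T}"
  have cl: "closed ?C" "closed ?E"
    using finite_cells cell_props(4) by (intro closed_Union; auto)+
  have "A \<subseteq> ?C \<union> ?E" using A(3) cells_cover by blast
  moreover have "?C \<inter> ?E \<inter> A = {}"
  proof (rule ccontr)
    assume "?C \<inter> ?E \<inter> A \<noteq> {}"
    then obtain y U U' where y: "y \<in> A" "U \<in> cells" "y \<in> U" "f U = g U" "U' \<in> cells" "y \<in> U'" "f U' \<noteq> g U'"
      by blast
    have ty: "tame {y}" using tame_subset[OF A(2)] y(1) by blast
    note cU = coherentD(1)[OF f y(2,3,1)]
    have "agree (f U') (g U')"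
      by (rule agree_trans_at[OF ty y(3,6,6) cU coherentD(1)[OF f y(5,6,1)] coherentD(1)[OF g y(5,6,1)]
            coherentD(2)[OF f y(2,3,1,5,6)] coherentD(2)[OF g y(2,3,1,5,6), folded y(4)]])
    then have "f U' = g U'"
      by (rule agree_same_cell[OF coherentD(1)[OF f y(5,6,1)] coherentD(1)[OF g y(5,6,1)]])
    with y(7) show False by blast
  qed
  moreover have "?C \<inter> A \<noteq> {}" "?E \<inter> A \<noteq> {}" using S T ne by blast+
  ultimately show False using connected_closedD[OF A(1) _ _ cl] by blast
qed

lemma nearby_segment_disjoint:
  fixes x :: "'a::euclidean_space"
  assumes "finite \<Q>" "\<And>Q. Q \<in> \<Q> \<Longrightarrow> closed Q"
  obtains \<delta> where "\<delta> > 0"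
    "\<And>Q y'. Q \<in> \<Q> \<Longrightarrow> dist y y' < \<delta> \<Longrightarrow> Q \<inter> closed_segment x y' \<noteq> {} \<Longrightarrow> Q \<inter> closed_segment x y \<noteq> {}"
proof -
  let ?B = "\<Union>{Q \<in> \<Q>. Q \<inter> closed_segment x y = {}}"
  have "closed ?B" using assms by (intro closed_Union) auto
  moreover have "closed_segment x y \<inter> ?B = {}" by blast
  ultimately obtain d where d: "d > 0" "\<And>u v. u \<in> closed_segment x y \<Longrightarrow> v \<in> ?B \<Longrightarrow> d \<le> dist u v"
    using separate_compact_closed[OF compact_segment, of ?B x y] by blast
  show ?thesis
  proof
    show "d > 0" by fact
    fix Q y' assume Q: "Q \<in> \<Q>" and y': "dist y y' < d" and "Q \<inter> closed_segment x y' \<noteq> {}"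
    then obtain t where t: "0 \<le> t" "t \<le> 1" "(1 - t) *\<^sub>R x + t *\<^sub>R y' \<in> Q"
      unfolding closed_segment_def by blast
    show "Q \<inter> closed_segment x y \<noteq> {}"
    proof
      assume "Q \<inter> closed_segment x y = {}"
      then have "(1 - t) *\<^sub>R x + t *\<^sub>R y' \<in> ?B" using Q t by blast
      then have "d \<le> dist ((1 - t) *\<^sub>R x + t *\<^sub>R y) ((1 - t) *\<^sub>R x + t *\<^sub>R y')"
        using d(2) t unfolding closed_segment_def by blast
      also have "\<dots> = t * dist y y'"
        using t(1) by (simp add: dist_norm flip: scaleR_diff_right)
      also have "\<dots> \<le> dist y y'" using t by (simp add: mult_left_le_one_le)
      finally show False using y' by simp
    qed
  qed
qed

text \<open>
  A family coherent along the segment from x to one point of the opposite side stays coherent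
  along the segments to nearby points, because these meet no further intersections of simplices.
  Hence the colouring of T is locally constant on that side.
\<close>

lemma coherent_triangle:
  assumes tri: "x \<in> space" "z \<in> space" "z' \<in> space" and tame: "tame (convex hull {x, z, z'})"
    and S: "coloring S e" "x \<in> S" and T: "T \<in> cells" "z \<in> T" "z' \<in> T"
    and f: "coherent (closed_segment x z) f" "f S = e"
    and f': "coherent (closed_segment x z') f'" "f' S = e"
  shows "f T = f' T"
proof -
  define y where "y t = (1 - t) *\<^sub>R z + t *\<^sub>R z'" for t
  have yT: "y t \<in> T" if "0 \<le> t" "t \<le> 1" for t
    unfolding y_def by (rule convexD_alt[OF cell_props(2)[OF T(1)] T(2,3) that])
  have sub: "closed_segment x (y t) \<subseteq> convex hull {x, z, z'}" if "0 \<le> t" "t \<le> 1" for t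
  proof (rule closed_segment_subset)
    show "x \<in> convex hull {x, z, z'}" by (simp add: hull_inc)
    have "z \<in> convex hull {x, z, z'}" "z' \<in> convex hull {x, z, z'}" by (simp_all add: hull_inc)
    then show "y t \<in> convex hull {x, z, z'}"
      unfolding y_def using convexD_alt[OF convex_convex_hull _ _ that] by blast
  qed simp
  have tame_t: "tame (closed_segment x (y t))" if "0 \<le> t" "t \<le> 1" for t
    using tame_subset[OF tame sub[OF that]] .
  have y_space: "y t \<in> space" if "0 \<le> t" "t \<le> 1" for t
    using yT[OF that] cell_props(7)[OF T(1)] by blast
  have seg_space: "closed_segment x (y t) \<subseteq> space" if "0 \<le> t" "t \<le> 1" for t
    by (rule closed_segment_subset[OF tri(1) y_space[OF that] convex_space])
  have Sc: "S \<in> cells" using coloring_frame(5)[OF S(1)] .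
  have uniq: "g T = g' T" if "0 \<le> t" "t \<le> 1" "coherent (closed_segment x (y t)) g" "g S = e"
    "coherent (closed_segment x (y t)) g'" "g' S = e" for g g' t
    by (rule coherent_unique[OF that(3,5) connected_segment(1) tame_t[OF that(1,2)] seg_space[OF that(1,2)] Sc])
      (use S(2) T that yT[OF that(1,2)] in auto)
  define F where "F t = (SOME g. coherent (closed_segment x (y t)) g \<and> g S = e)" for t
  have F: "coherent (closed_segment x (y t)) (F t)" "F t S = e" if t: "0 \<le> t" "t \<le> 1" for t
  proof -
    obtain g where "coherent (closed_segment x (y t)) g \<and> g S = e"
      using coherent_along_segment[OF tri(1) y_space[OF t] tame_t[OF t] S] by metis
    then have "coherent (closed_segment x (y t)) (F t) \<and> F t S = e"
      unfolding F_def by (rule someI[where P = "\<lambda>g. coherent (closed_segment x (y t)) g \<and> g S = e"])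
    then show "coherent (closed_segment x (y t)) (F t)" "F t S = e" by auto
  qed
  have "0 \<le> (0::real) \<and> (1::real) \<le> 1 \<longrightarrow> F 0 T = F 1 T"
  proof (rule Bolzano[of 0 1 "\<lambda>a b. 0 \<le> a \<and> b \<le> 1 \<longrightarrow> F a T = F b T"])
    fix t :: real
    assume t: "0 \<le> t" "t \<le> 1"
    let ?Q = "(\<lambda>(S, T). S \<inter> T) ` (cells \<times> cells)"
    obtain \<delta> where \<delta>: "\<delta> > 0" "\<And>Q y'. Q \<in> ?Q \<Longrightarrow> dist (y t) y' < \<delta> \<Longrightarrow>
        Q \<inter> closed_segment x y' \<noteq> {} \<Longrightarrow> Q \<inter> closed_segment x (y t) \<noteq> {}"
    proof (rule nearby_segment_disjoint[of ?Q "y t" x])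
      show "finite ?Q" using finite_cells by simp
      show "closed Q" if "Q \<in> ?Q" for Q using that cell_props(4) by auto
    qed blast
    define d where "d = \<delta> / (norm (z' - z) + 1)"
    have den: "norm (z' - z) + 1 > 0" by (simp add: add_nonneg_pos)
    have d0: "d > 0" using \<delta>(1) den by (simp add: d_def)
    have near: "F s T = F t T" if s: "0 \<le> s" "s \<le> 1" "\<bar>s - t\<bar> < d" for s
    proof -
      have "y t - y s = (t - s) *\<^sub>R (z' - z)" unfolding y_def by (simp add: algebra_simps)
      then have "dist (y t) (y s) = \<bar>s - t\<bar> * norm (z' - z)"
        by (simp add: dist_norm abs_minus_commute)
      also have "\<dots> \<le> \<bar>s - t\<bar> * (norm (z' - z) + 1)" by (intro mult_left_mono) auto
      also have "\<dots> < d * (norm (z' - z) + 1)" using s(3) den by (rule mult_strict_right_mono)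
      also have "\<dots> = \<delta>" using den by (simp add: d_def)
      finally have ds: "dist (y t) (y s) < \<delta>" .
      have coh: "coherent (closed_segment x (y s)) (F t)"
      proof (rule coherent_mono[OF F(1)[OF t]])
        fix S T assume "S \<in> cells" "T \<in> cells" "S \<inter> T \<inter> closed_segment x (y s) \<noteq> {}"
        then show "S \<inter> T \<inter> closed_segment x (y t) \<noteq> {}" using \<delta>(2)[OF _ ds, of "S \<inter> T"] by auto
      qed
      show ?thesis by (rule uniq[OF s(1,2) F(1)[OF s(1,2)] F(2)[OF s(1,2)] coh F(2)[OF t]])
    qed
    show "\<exists>d>0. \<forall>a b. a \<le> t \<and> t \<le> b \<and> b - a < d \<longrightarrow> 0 \<le> a \<and> b \<le> 1 \<longrightarrow> F a T = F b T"
    proof (intro exI[of _ d] conjI allI impI)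
      fix a b assume ab: "a \<le> t \<and> t \<le> b \<and> b - a < d" "0 \<le> a \<and> b \<le> 1"
      have "F a T = F t T" by (rule near) (use ab t in auto)
      moreover have "F b T = F t T" by (rule near) (use ab t in auto)
      ultimately show "F a T = F b T" by simp
    qed (rule d0)
  qed auto
  moreover have "f T = F 0 T"
  proof (rule uniq)
    show "coherent (closed_segment x (y 0)) f" using f(1) by (simp add: y_def)
    show "coherent (closed_segment x (y 0)) (F 0)" "F 0 S = e" using F[of 0] by auto
  qed (use f(2) in auto)
  moreover have "f' T = F 1 T"
  proof (rule uniq)
    show "coherent (closed_segment x (y 1)) f'" using f'(1) by (simp add: y_def)
    show "coherent (closed_segment x (y 1)) (F 1)" "F 1 S = e" using F[of 1] by auto
  qed (use f'(2) in auto)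
  ultimately show ?thesis by simp
qed

subsection \<open>Consistency across facets and at vertices\<close>

lemma cells_nonempty: "cells \<noteq> {}"
proof
  assume "cells = {}"
  then have "space = {}" using cells_cover by simp
  then have "int CARD('d) = -1" using full_dim by (metis aff_dim_empty)
  then show False by simp
qed

lemma coloring_ex:
  assumes "T \<in> cells"
  obtains e where "coloring T e"
proof -
  obtain e where e: "frame_det e \<noteq> 0" "inj e" "\<not> affine_dependent (range e)" "T = convex hull (range e)"
    by (rule cell_frame[OF assms])
  have "coloring T e \<or> coloring T (e \<circ> Transposition.transpose None (Some undefined))"
    by (rule coloring_swap[OF assms e(4) _ e(2)]) simp
  then show ?thesis using that by blast
qed

text \<open>
  For two generic end points in the same simplex the triangle with the base point x need not be
  generic; a third end point, generic with respect to both, mediates. Simplices with a common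
  part F of codimension at most one are compared at a generic point of F, where one coherent
  family colours both.
\<close>

lemma global_coloring:
  obtains b where "\<And>T. T \<in> cells \<Longrightarrow> coloring T (b T)"
    "\<And>S T F. \<lbrakk>S \<in> cells; T \<in> cells; convex F; F \<subseteq> S \<inter> T; int CARD('d) - 1 \<le> aff_dim F\<rbrakk> \<Longrightarrow> agree (b S) (b T)"
proof -
  let ?m = "CARD('d) - 1"
  obtain S0 where S0: "S0 \<in> cells" using cells_nonempty by blast
  obtain e0 where e0: "coloring S0 e0" using coloring_ex[OF S0] .
  have nsub: "\<not> C \<subseteq> affine hull (U \<union> V)"
    if "\<not> affine_dependent U" "card U < ?m" "finite V" "int (card V) + int CARD('d) - 2 \<le> aff_dim C" for C U and V :: "(real ^ 'd) set"
  proof (rule not_subset_affine_hull)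
    show "finite (U \<union> V)" using that aff_independent_finite by blast
    have "card (U \<union> V) \<le> card U + card V" by (rule card_Un_le)
    then show "int (card (U \<union> V)) \<le> aff_dim C" using that by linarith
  qed
  obtain x where x: "x \<in> S0"
    "\<And>U. \<not> affine_dependent U \<Longrightarrow> convex hull U \<in> \<Gamma> \<Longrightarrow> card U < ?m \<Longrightarrow> x \<notin> affine hull (U \<union> {})"
  proof (rule generic_point[of S0 ?m "{}" "{}"])
    show "\<not> S0 \<subseteq> affine hull (U \<union> {}) \<and> \<not> S0 \<subseteq> affine hull (U \<union> {})"
      if "\<not> affine_dependent U" "card U < ?m" for U
      using nsub[OF that, of "{}" S0] cell_props(6)[OF S0] by simp
  qed (use cell_props[OF S0] in auto)
  have x_space: "x \<in> space" using x(1) cell_props(7)[OF S0] by blast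
  have tame_x: "tame {x}"
    unfolding avoids_def using x(2) convex_hull_subset_affine_hull by fastforce
  define good where "good z \<longleftrightarrow> (\<forall>U. \<not> affine_dependent U \<and> convex hull U \<in> \<Gamma> \<and> card U < ?m \<longrightarrow>
    z \<notin> affine hull (U \<union> {x}))" for z
  have tame_seg: "tame (closed_segment x z)" if "good z" for z
  proof -
    have "tame (convex hull (insert z {x}))"
      by (rule avoids_cone[OF tame_x]) (use that in \<open>auto simp: good_def\<close>)
    then show ?thesis by (simp add: segment_convex_hull insert_commute)
  qed
  have good_ex: "\<exists>z\<in>F. good z" if F: "convex F" "int CARD('d) - 1 \<le> aff_dim F" for F
  proof -
    have "F \<noteq> {}" using F(2) by auto
    obtain z where "z \<in> F" "\<And>U. \<not> affine_dependent U \<Longrightarrow> convex hull U \<in> \<Gamma> \<Longrightarrow> card U < ?m \<Longrightarrow>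
      z \<notin> affine hull (U \<union> {x}) \<and> z \<notin> affine hull (U \<union> {x})"
      by (rule generic_point[OF F(1) \<open>F \<noteq> {}\<close>, of ?m "{x}" "{x}"]) (use nsub[of _ "{x}" F] F(2) in auto)
    then show ?thesis unfolding good_def by blast
  qed
  define reach where "reach T e \<longleftrightarrow> (\<exists>z\<in>T. good z \<and>
    (\<exists>f. coherent (closed_segment x z) f \<and> f S0 = e0 \<and> f T = e))" for T e
  have along: "\<exists>f. coherent (closed_segment x z) f \<and> f S0 = e0" if "good z" "z \<in> space" for z
    using coherent_along_segment[OF x_space that(2) tame_seg[OF that(1)] e0 x(1)] by metis
  have step: "f T = f' T"
    if T: "T \<in> cells" and z: "z \<in> T" "good z" and w: "w \<in> T"
      "\<And>U. \<not> affine_dependent U \<Longrightarrow> convex hull U \<in> \<Gamma> \<Longrightarrow> card U < ?m \<Longrightarrow> w \<notin> affine hull (U \<union> {x, z})"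
      and f: "coherent (closed_segment x z) f" "f S0 = e0"
      and f': "coherent (closed_segment x w) f'" "f' S0 = e0" for T z w f f'
  proof (rule coherent_triangle[OF x_space _ _ _ e0 x(1) T z(1) w(1) f f'])
    show "z \<in> space" "w \<in> space" using z w cell_props(7)[OF T] by blast+
    have "tame (convex hull (insert w (closed_segment x z)))"
      by (rule avoids_cone[OF tame_seg[OF z(2)]]) (use w(2) affine_hull_segment_subset in \<open>blast+\<close>)
    moreover have "convex hull {x, z, w} \<subseteq> convex hull (insert w (closed_segment x z))"
      by (rule hull_mono) auto
    ultimately show "tame (convex hull {x, z, w})" by (rule tame_subset)
  qed
  have reach_unique: "e = e'" if T: "T \<in> cells" and e: "reach T e" and e': "reach T e'" for T e e'
  proof -
    obtain z f where z: "z \<in> T" "good z" and f: "coherent (closed_segment x z) f" "f S0 = e0" "f T = e"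
      using e unfolding reach_def by blast
    obtain z' f' where z': "z' \<in> T" "good z'" and f': "coherent (closed_segment x z') f'" "f' S0 = e0" "f' T = e'"
      using e' unfolding reach_def by blast
    have two: "int (card {x, u}) + int CARD('d) - 2 \<le> aff_dim T" for u
      using cell_props(6)[OF T] by (simp add: card_insert_if)
    obtain w where w: "w \<in> T" "\<And>U. \<not> affine_dependent U \<Longrightarrow> convex hull U \<in> \<Gamma> \<Longrightarrow> card U < ?m \<Longrightarrow>
      w \<notin> affine hull (U \<union> {x, z}) \<and> w \<notin> affine hull (U \<union> {x, z'})"
    proof (rule generic_point[of T ?m "{x, z}" "{x, z'}"])
      show "\<not> T \<subseteq> affine hull (U \<union> {x, z}) \<and> \<not> T \<subseteq> affine hull (U \<union> {x, z'})"
        if "\<not> affine_dependent U" "card U < ?m" for U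
        using nsub[OF that _ two] by blast
    qed (use cell_props[OF T] in auto)
    have "good w"
      unfolding good_def
    proof (intro allI impI notI)
      fix U assume "\<not> affine_dependent U \<and> convex hull U \<in> \<Gamma> \<and> card U < ?m" "w \<in> affine hull (U \<union> {x})"
      moreover have "affine hull (U \<union> {x}) \<subseteq> affine hull (U \<union> {x, z})" by (rule hull_mono) auto
      ultimately show False using w(2) by blast
    qed
    then obtain g where g: "coherent (closed_segment x w) g" "g S0 = e0"
      using along w(1) cell_props(7)[OF T] by blast
    have "f T = g T" by (rule step[OF T z w(1) _ f(1,2) g]) (use w(2) in blast)
    moreover have "f' T = g T" by (rule step[OF T z' w(1) _ f'(1,2) g]) (use w(2) in blast)
    ultimately show "e = e'" using f f' by simp
  qed
  define b where "b T = (THE e. reach T e)" for T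
  have b: "b T = f T" if "T \<in> cells" "z \<in> T" "good z" "coherent (closed_segment x z) f" "f S0 = e0" for T z f
    unfolding b_def
  proof (rule the_equality)
    show r: "reach T (f T)" unfolding reach_def using that by blast
    show "\<And>e. reach T e \<Longrightarrow> e = f T" using reach_unique[OF that(1)] r by blast
  qed
  show ?thesis
  proof
    fix T assume T: "T \<in> cells"
    obtain z where z: "z \<in> T" "good z" using good_ex[of T] cell_props[OF T] by auto
    then obtain f where f: "coherent (closed_segment x z) f" "f S0 = e0" using along cell_props(7)[OF T] by blast
    show "coloring T (b T)"
      unfolding b[OF T z f] by (rule coherentD(1)[OF f(1) T z(1)]) simp
  next
    fix S T F assume ST: "S \<in> cells" "T \<in> cells" "convex F" "F \<subseteq> S \<inter> T" "int CARD('d) - 1 \<le> aff_dim F"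
    obtain z where z: "z \<in> F" "good z" using good_ex ST by blast
    then have zz: "z \<in> S" "z \<in> T" using ST by auto
    then obtain f where f: "coherent (closed_segment x z) f" "f S0 = e0"
      using along z cell_props(7)[OF ST(1)] by blast
    show "agree (b S) (b T)"
      unfolding b[OF ST(1) zz(1) z(2) f] b[OF ST(2) zz(2) z(2) f]
      by (rule coherentD(2)[OF f(1) ST(1) zz(1) _ ST(2) zz(2)]) simp
  qed
qed

text \<open>
  A short segment near v between the two simplices, avoiding faces of codimension at least two,
  meets only simplices at v, and two distinct ones with a common point on the segment share a
  facet. So the set where v has the colour k and the set where it has not are closed and
  disjoint on it.
\<close>

lemma vertex_coloring:
  obtains b where "\<And>T. T \<in> cells \<Longrightarrow> coloring T (b T)" "\<And>S T. S \<in> cells \<Longrightarrow> T \<in> cells \<Longrightarrow> agree (b S) (b T)"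
proof -
  obtain b where b: "\<And>T. T \<in> cells \<Longrightarrow> coloring T (b T)"
    and facet: "\<And>S T F. \<lbrakk>S \<in> cells; T \<in> cells; convex F; F \<subseteq> S \<inter> T; int CARD('d) - 1 \<le> aff_dim F\<rbrakk> \<Longrightarrow> agree (b S) (b T)"
    using global_coloring by blast
  have "k = l" if S: "S \<in> cells" and T: "T \<in> cells" and v: "b S k = v" "b T l = v" for S T k l v
  proof -
    have vS: "v \<in> S" and vT: "v \<in> T"
      using v coloring_frame(4)[OF b[OF S]] coloring_frame(4)[OF b[OF T]] by (metis hull_inc rangeI)+
    have v\<Gamma>: "convex hull {v} \<in> \<Gamma>"
      by (rule simplicial_complex_face[OF complex, of "range (b S)"])
        (use coloring_frame[OF b[OF S]] cell_props(1)[OF S] v in auto)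
    have vertex: "v \<in> range (b T')" if T': "T' \<in> cells" "v \<in> T'" for T'
    proof -
      note F = coloring_frame[OF b[OF T'(1)]]
      have "convex hull {v} \<inter> convex hull (range (b T')) = convex hull ({v} \<inter> range (b T'))"
        by (rule simplicial_complex_Int[OF complex v\<Gamma>]) (use F cell_props(1)[OF T'(1)] in auto)
      then have "convex hull ({v} \<inter> range (b T')) \<noteq> {}" using T'(2) F(4) by auto
      then show ?thesis by auto
    qed
    have "closed (\<Union>{T' \<in> cells. v \<notin> T'})" using finite_cells cell_props(4) by (intro closed_Union) auto
    then obtain r where r: "r > 0" "ball v r \<inter> \<Union>{T' \<in> cells. v \<notin> T'} = {}"
      by (rule ball_disjoint_closed) auto
    let ?m = "CARD('d)"
    have nsub: "\<not> R \<inter> ball v r \<subseteq> affine hull (U \<union> V)"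
      if "\<not> affine_dependent U" "card U < ?m" "finite V" "card V \<le> 1" "R \<in> cells" "v \<in> R" for R U and V :: "(real ^ 'd) set"
    proof -
      have "\<not> R \<subseteq> affine hull (U \<union> V)"
      proof (rule not_subset_affine_hull)
        show "finite (U \<union> V)" using that aff_independent_finite by blast
        have "card (U \<union> V) \<le> card U + card V" by (rule card_Un_le)
        then show "int (card (U \<union> V)) \<le> aff_dim R" using that cell_props(6) by simp
      qed
      then show ?thesis
        using convex_ball_subset_affine[OF cell_props(2)[OF that(5)] that(6) r(1) affine_affine_hull] by blast
    qed
    have cb: "convex (R \<inter> ball v r)" "v \<in> R \<Longrightarrow> R \<inter> ball v r \<noteq> {}" if "R \<in> cells" for R
      using cell_props(2)[OF that] r(1) by (auto simp: convex_Int)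
    obtain x where x: "x \<in> S \<inter> ball v r" "\<And>U. \<not> affine_dependent U \<Longrightarrow> convex hull U \<in> \<Gamma> \<Longrightarrow> card U < ?m \<Longrightarrow>
      x \<notin> affine hull (U \<union> {}) \<and> x \<notin> affine hull (U \<union> {})"
      by (rule generic_point[OF cb(1)[OF S] cb(2)[OF S vS], of ?m "{}" "{}"]) (use nsub[of _ "{}"] S vS in auto)
    obtain y where y: "y \<in> T \<inter> ball v r" "\<And>U. \<not> affine_dependent U \<Longrightarrow> convex hull U \<in> \<Gamma> \<Longrightarrow> card U < ?m \<Longrightarrow>
      y \<notin> affine hull (U \<union> {x}) \<and> y \<notin> affine hull (U \<union> {x})"
      by (rule generic_point[OF cb(1)[OF T] cb(2)[OF T vT], of ?m "{x}" "{x}"]) (use nsub[of _ "{x}"] T vT in auto)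
    let ?A = "closed_segment x y"
    have "avoids ?m {x}"
      unfolding avoids_def using x(2) convex_hull_subset_affine_hull by fastforce
    then have "avoids ?m (convex hull (insert y {x}))"
      by (rule avoids_cone) (use y(2) in auto)
    then have av: "avoids ?m ?A" by (simp add: segment_convex_hull insert_commute)
    have "x \<in> space" "y \<in> space" using x(1) y(1) cell_props(7)[OF S] cell_props(7)[OF T] by blast+
    then have A: "?A \<subseteq> space" "?A \<subseteq> ball v r"
      using closed_segment_subset[of x _ y] convex_space convex_ball[of v r] x(1) y(1) by blast+
    let ?P = "\<lambda>T'. T' \<in> cells \<and> v \<in> T' \<and> b T' k = v" and ?N = "\<lambda>T'. T' \<in> cells \<and> v \<in> T' \<and> b T' k \<noteq> v"
    have cl: "closed (\<Union>{T'. ?P T'})" "closed (\<Union>{T'. ?N T'})"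
      using finite_cells cell_props(4) by (intro closed_Union; auto)+
    have cov: "?A \<subseteq> \<Union>{T'. ?P T'} \<union> \<Union>{T'. ?N T'}"
    proof
      fix q assume q: "q \<in> ?A"
      then obtain T' where T': "T' \<in> cells" "q \<in> T'" using A(1) cells_cover by blast
      then have "v \<in> T'" using r(2) A(2) q by blast
      then show "q \<in> \<Union>{T'. ?P T'} \<union> \<Union>{T'. ?N T'}" using T' by blast
    qed
    have disj: "\<Union>{T'. ?P T'} \<inter> \<Union>{T'. ?N T'} \<inter> ?A = {}"
    proof (rule ccontr)
      assume "\<Union>{T'. ?P T'} \<inter> \<Union>{T'. ?N T'} \<inter> ?A \<noteq> {}"
      then obtain q R R' where q: "q \<in> ?A" "?P R" "q \<in> R" "?N R'" "q \<in> R'" by blast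
      have cells: "R \<in> cells" "R' \<in> cells" using q by auto
      note F = coloring_frame[OF b[OF cells(1)]] and F' = coloring_frame[OF b[OF cells(2)]]
      let ?U = "range (b R) \<inter> range (b R')"
      have int: "R \<inter> R' = convex hull ?U"
        using simplicial_complex_Int[OF complex _ F(3) _ F'(3)] F(4) F'(4) cell_props(1) cells by metis
      have ind: "\<not> affine_dependent ?U" using affine_independent_subset[OF F(3)] by blast
      have "convex hull ?U \<in> \<Gamma>"
        by (rule simplicial_complex_face[OF complex, of "range (b R)"]) (use F cell_props(1)[OF cells(1)] in auto)
      then have "\<not> card ?U < ?m" using av ind int q unfolding avoids_def by blast
      then have "int ?m - 1 \<le> aff_dim (R \<inter> R')"
        using aff_dim_affine_independent[OF ind] unfolding int aff_dim_convex_hull by linarith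
      then have ag: "agree (b R) (b R')"
        by (intro facet[of R R' "R \<inter> R'"]) (use cells cell_props(2) in \<open>auto simp: convex_Int\<close>)
      obtain l where "v = b R' l" using vertex q by blast
      then show False using ag q unfolding agree_def by metis
    qed
    have "x \<in> \<Union>{T'. ?P T'} \<inter> ?A" using x(1) S vS v by auto
    then have "\<Union>{T'. ?N T'} \<inter> ?A = {}"
      using connected_closedD[OF connected_segment(1)[of x y] disj cov cl] by blast
    moreover have "y \<in> T" "y \<in> ?A" using y(1) by auto
    ultimately have "b T k = v" using T vT by blast
    then show "k = l" using v(2) coloring_frame(2)[OF b[OF T]] by (metis injD)
  qed
  then have "agree (b S) (b T)" if "S \<in> cells" "T \<in> cells" for S T
    using that unfolding agree_def by blast
  with b that show ?thesis by blast
qed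

text \<open>
  The ends of an edge are vertices of any cell that contains its midpoint, and there they have
  different colours.
\<close>

lemma balanced_if_alternating: "balanced A CARD('d) \<Gamma>"
proof -
  obtain b where b: "\<And>T. T \<in> cells \<Longrightarrow> coloring T (b T)"
    and agree: "\<And>S T. S \<in> cells \<Longrightarrow> T \<in> cells \<Longrightarrow> agree (b S) (b T)"
    using vertex_coloring by blast
  obtain \<kappa> :: "'d option \<Rightarrow> nat" where \<kappa>: "bij_betw \<kappa> UNIV {1..CARD('d) + 1}"
    using finite_same_card_bij[of "UNIV :: 'd option set" "{1..CARD('d) + 1}"] by (auto simp: card_UNIV_option)
  define \<gamma> where "\<gamma> v = \<kappa> (SOME k. \<exists>T\<in>cells. b T k = v)" for v
  have \<gamma>: "\<gamma> (b T k) = \<kappa> k" if T: "T \<in> cells" for T k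
  proof -
    have "(SOME k'. \<exists>S\<in>cells. b S k' = b T k) = k"
    proof (rule some_equality)
      show "\<exists>S\<in>cells. b S k = b T k" using T by blast
      show "k' = k" if "\<exists>S\<in>cells. b S k' = b T k" for k'
        using that agree T unfolding agree_def by blast
    qed
    then show ?thesis by (simp add: \<gamma>_def)
  qed
  show ?thesis
    unfolding balanced_def
  proof (intro exI[of _ \<gamma>] conjI ballI impI)
    show "\<gamma> ` A \<subseteq> {1..CARD('d) + 1}" using \<kappa> unfolding \<gamma>_def bij_betw_def by blast
    fix x y assume xy: "x \<noteq> y \<and> convex hull {x, y} \<in> \<Gamma>"
    have mid: "midpoint x y \<in> convex hull {x, y}"
      by (simp add: segment_convex_hull[symmetric])
    then obtain T where T: "T \<in> cells" "midpoint x y \<in> T" using xy cells_cover by blast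
    note F = coloring_frame[OF b[OF T(1)]]
    have "convex hull {x, y} \<inter> convex hull (range (b T)) = convex hull ({x, y} \<inter> range (b T))"
      by (rule simplicial_complex_Int[OF complex _ affine_independent_2])
        (use xy F cell_props(1)[OF T(1)] in auto)
    then have m: "midpoint x y \<in> convex hull ({x, y} \<inter> range (b T))" using mid T F(4) by blast
    have "x \<in> range (b T) \<and> y \<in> range (b T)"
    proof (rule ccontr)
      assume "\<not> (x \<in> range (b T) \<and> y \<in> range (b T))"
      then have "{x, y} \<inter> range (b T) \<subseteq> {x} \<or> {x, y} \<inter> range (b T) \<subseteq> {y}" by auto
      then have "midpoint x y \<in> convex hull {x} \<or> midpoint x y \<in> convex hull {y}"
        using m hull_mono by blast
      then show False using xy by (auto simp: midpoint_eq_endpoint)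
    qed
    then obtain k l where kl: "x = b T k" "y = b T l" by blast
    then have "k \<noteq> l" using xy by auto
    then show "\<gamma> x \<noteq> \<gamma> y" unfolding kl \<gamma>[OF T(1)] using \<kappa> by (auto simp: bij_betw_def dest: injD)
  qed
qed

end

section \<open>The equivalence\<close>

lemma bipartite_imp_balanced:
  fixes \<Gamma> :: "(real ^ 'd) set set"
  assumes full: "aff_dim (convex hull A) = int CARD('d)" and tri: "triangulates \<Gamma> A"
    and bip: "bipartite (dual_graph CARD('d) \<Gamma>)"
  shows "balanced A CARD('d) \<Gamma>"
proof -
  obtain X Y where XY: "X \<inter> Y = {}" "\<And>E. E \<in> snd (dual_graph CARD('d) \<Gamma>) \<Longrightarrow> \<exists>x\<in>X. \<exists>y\<in>Y. E = {x, y}"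
    using bip unfolding bipartite_def by metis
  interpret alternating_complex \<Gamma> "\<lambda>S. if S \<in> X then 1 else -1"
  proof
    show "simplicial_complex \<Gamma>" "convex (\<Union>\<Gamma>)" "aff_dim (\<Union>\<Gamma>) = int CARD('d)"
      using tri full unfolding triangulates_def by auto
    fix S T F assume ST: "S \<in> \<Gamma>" "T \<in> \<Gamma>" "int CARD('d) simplex S" "int CARD('d) simplex T" "S \<noteq> T"
      "F facet_of S" "F facet_of T"
    then have "{S, T} \<in> snd (dual_graph CARD('d) \<Gamma>)" unfolding dual_graph_def by auto
    then obtain x y where "x \<in> X" "y \<in> Y" "{S, T} = {x, y}" using XY(2) by blast
    then have "S \<in> X \<longleftrightarrow> T \<notin> X" using XY(1) by (auto simp: doubleton_eq_iff)
    then show "(if S \<in> X then 1 else -1 :: real) \<noteq> (if T \<in> X then 1 else -1)" by auto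
  qed auto
  show ?thesis by (rule balanced_if_alternating)
qed

theorem mainTheorem1:
  fixes a :: "nat \<Rightarrow> real ^ 'd"
    and n :: nat
    and \<Gamma> :: "(real ^ 'd) set set"
  assumes "inj_on a {..<n}"
    and "aff_dim (convex hull (a ` {..<n})) = int CARD('d)"
    and "triangulates \<Gamma> (a ` {..<n})"
  shows "(balanced (a ` {..<n}) CARD('d) \<Gamma> \<longleftrightarrow>
           (\<exists>C \<in> carrier_mat CARD('d) n.
              \<forall>S\<in>\<Gamma>. int CARD('d) simplex S \<longrightarrow> positively_decorates C a S)) \<and>
         ((\<exists>C \<in> carrier_mat CARD('d) n.
              \<forall>S\<in>\<Gamma>. int CARD('d) simplex S \<longrightarrow> positively_decorates C a S) \<longleftrightarrow>
           bipartite (dual_graph CARD('d) \<Gamma>))"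
proof -
  let ?bal = "balanced (a ` {..<n}) CARD('d) \<Gamma>" and ?bip = "bipartite (dual_graph CARD('d) \<Gamma>)"
  let ?dec = "\<exists>C \<in> carrier_mat CARD('d) n.
    \<forall>S\<in>\<Gamma>. int CARD('d) simplex S \<longrightarrow> positively_decorates C a S"
  have 1: "?bal \<Longrightarrow> ?dec" using balanced_imp_decorated[OF assms(1,3)] by metis
  have 2: "?dec \<Longrightarrow> ?bip" using decorated_imp_bipartite[OF assms(1,3)] by blast
  have 3: "?bip \<Longrightarrow> ?bal" by (rule bipartite_imp_balanced[OF assms(2,3)])
  from 1 2 3 show ?thesis by blast
qed

end
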